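(* Let $T>0$, let $A,B\subset[0,2\pi]$ be measurable, and let $G\subset[0,T]\times[0,2\pi]$ be a measurable set that is $(A,B;T)$-observable symmetric. Let $f\in L^2((0,T)\times\mathbb{T})$ and let $(u,\partial_t u)\in C([0,T];H^1(\mathbb{T})\times L^2(\mathbb{T}))$ be a solution of $$(\partial_t^2-\partial_x^2)u=f\chi_G,\qquad (u,\partial_t u)|_{t=0}\in H^1(\mathbb{T})\times L^2(\mathbb{T}).$$ Define $$I(t)=\int_{A-t}(\partial_x u+\partial_t u)(t,x)\,dx+\int_{B+t}(\partial_x u-\partial_t u)(t,x)\,dx,$$ where $A-t=\{x-t \bmod 2\pi:x\in A\}$ and $B+t=\{x+t\bmod 2\pi:x\in B\}$. Then $I(t)=I(0)$ for all $t\in[0,T]$. In the case $|A|=|B|=2\pi$, this conservation reduces to the condition $\int_{\mathbb{T}}\partial_x u(t,x)\,dx=0$.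
   Context: $\mathbb{T}=\mathbb{R}/2\pi\mathbb{Z}$, and functions on $\mathbb{T}$ are identified with $2\pi$-periodic functions on $\mathbb{R}$. Points $(t,x)$ have time coordinate $t$ first. $|A|$ is the Lebesgue measure of $A$, $\mathrm{meas}_{\mathbb{R}^2}$ is planar Lebesgue measure, and $\chi_G$ is the indicator function of $G$. For measurable $A,B\subset[0,2\pi]$ set $$L_{\xi\in A}^T=\{(t,x)\in[0,T]\times\mathbb{R}:\ x+t\in A+2\pi\mathbb{Z}\},\qquad L_{\eta\in B}^T=\{(t,x)\in[0,T]\times\mathbb{R}:\ x-t\in B+2\pi\mathbb{Z}\}.$$ $G$ is $(A,B;T)$-observable symmetric if $\mathrm{meas}_{\mathbb{R}^2}\big([G\cap L_{\xi\in A}^T]\,\Delta\,[G\cap L_{\eta\in B}^T]\big)=0$, where $\Delta$ is the symmetric difference. *)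

theory Defs
  imports "HOL-Analysis.Analysis" "HOL-Library.Real_Mod"
begin

text \<open>
  Functions on the torus \<open>\<real>/2\<pi>\<int>\<close> are \<open>2\<pi>\<close>-periodic functions on \<open>\<real>\<close>, and classes of functions
  modulo equality almost everywhere are handled through representatives. All integrals over the
  torus are taken over the fundamental domain \<open>[0, 2\<pi>]\<close>.
\<close>

definition periodic_2pi :: "(real \<Rightarrow> 'a) \<Rightarrow> bool" where
  "periodic_2pi g \<longleftrightarrow> (\<forall>x. g (x + 2 * pi) = g x)"

definition L2_torus :: "(real \<Rightarrow> complex) set" where
  "L2_torus = {g. periodic_2pi g \<and> g \<in> borel_measurable lebesgue \<and>
     set_integrable lebesgue {0..2*pi} (\<lambda>x. (norm (g x))\<^sup>2)}"

definition L2_norm :: "(real \<Rightarrow> complex) \<Rightarrow> real" where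
  "L2_norm g = sqrt (LINT x:{0..2*pi}|lebesgue. (norm (g x))\<^sup>2)"

definition test_torus :: "(real \<Rightarrow> real) set" where
  "test_torus = {\<phi>. periodic_2pi \<phi> \<and> (\<forall>n x. ((deriv ^^ n) \<phi>) differentiable (at x))}"

definition has_weak_deriv :: "(real \<Rightarrow> complex) \<Rightarrow> (real \<Rightarrow> complex) \<Rightarrow> bool" where
  "has_weak_deriv g h \<longleftrightarrow> (\<forall>\<phi>\<in>test_torus.
     (LINT x:{0..2*pi}|lebesgue. deriv \<phi> x *\<^sub>R g x) = - (LINT x:{0..2*pi}|lebesgue. \<phi> x *\<^sub>R h x))"

definition H1_torus :: "(real \<Rightarrow> complex) set" where
  "H1_torus = {g \<in> L2_torus. \<exists>h\<in>L2_torus. has_weak_deriv g h}"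

text \<open>A representative of the weak derivative, which is unique up to null sets.\<close>

definition weak_deriv :: "(real \<Rightarrow> complex) \<Rightarrow> real \<Rightarrow> complex" where
  "weak_deriv g = (SOME h. h \<in> L2_torus \<and> has_weak_deriv g h)"

definition H1_norm :: "(real \<Rightarrow> complex) \<Rightarrow> real" where
  "H1_norm g = sqrt ((L2_norm g)\<^sup>2 + (L2_norm (weak_deriv g))\<^sup>2)"

definition C_H1_L2 :: "real \<Rightarrow> (real \<Rightarrow> real \<Rightarrow> complex) \<Rightarrow> (real \<Rightarrow> real \<Rightarrow> complex) \<Rightarrow> bool" where
  "C_H1_L2 T u v \<longleftrightarrow>
     (\<forall>t\<in>{0..T}. u t \<in> H1_torus \<and> v t \<in> L2_torus) \<and>
     (\<forall>t\<^sub>0\<in>{0..T}.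
        ((\<lambda>t. H1_norm (\<lambda>x. u t x - u t\<^sub>0 x)) \<longlongrightarrow> 0) (at t\<^sub>0 within {0..T}) \<and>
        ((\<lambda>t. L2_norm (\<lambda>x. v t x - v t\<^sub>0 x)) \<longlongrightarrow> 0) (at t\<^sub>0 within {0..T}))"

definition L2_cylinder :: "real \<Rightarrow> (real \<times> real \<Rightarrow> complex) set" where
  "L2_cylinder T = {f. (\<forall>t\<in>{0<..<T}. periodic_2pi (\<lambda>x. f (t, x))) \<and>
     set_borel_measurable lebesgue ({0<..<T} \<times> {0..2*pi}) f \<and>
     set_integrable lebesgue ({0<..<T} \<times> {0..2*pi}) (\<lambda>p. (norm (f p))\<^sup>2)}"

definition dt :: "(real \<times> real \<Rightarrow> real) \<Rightarrow> real \<times> real \<Rightarrow> real" where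
  "dt \<phi> = (\<lambda>(t, x). deriv (\<lambda>s. \<phi> (s, x)) t)"

definition dx :: "(real \<times> real \<Rightarrow> real) \<Rightarrow> real \<times> real \<Rightarrow> real" where
  "dx \<phi> = (\<lambda>(t, x). deriv (\<lambda>y. \<phi> (t, y)) x)"

primrec C_k :: "nat \<Rightarrow> (real \<times> real \<Rightarrow> real) \<Rightarrow> bool" where
  "C_k 0 \<phi> \<longleftrightarrow> continuous_on UNIV \<phi>"
| "C_k (Suc k) \<phi> \<longleftrightarrow> continuous_on UNIV \<phi> \<and>
     (\<forall>t x. (\<lambda>s. \<phi> (s, x)) differentiable (at t) \<and> (\<lambda>y. \<phi> (t, y)) differentiable (at x)) \<and>
     C_k k (dt \<phi>) \<and> C_k k (dx \<phi>)"

text \<open>Smooth functions on \<open>(0, T) \<times> \<real>/2\<pi>\<int>\<close> with compact support, extended by zero in time.\<close>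

definition test_cylinder :: "real \<Rightarrow> (real \<times> real \<Rightarrow> real) set" where
  "test_cylinder T = {\<phi>. (\<forall>k. C_k k \<phi>) \<and> (\<forall>t. periodic_2pi (\<lambda>x. \<phi> (t, x))) \<and>
     (\<exists>a b. 0 < a \<and> b < T \<and> (\<forall>t x. \<phi> (t, x) \<noteq> 0 \<longrightarrow> a \<le> t \<and> t \<le> b))}"

text \<open>
  The distribution on \<open>(0, T) \<times> \<real>/2\<pi>\<int>\<close> given by \<open>w \<in> C([0, T]; L\<^sup>2)\<close>. The iterated integral does
  not depend on the representatives of the slices \<open>w t\<close>, which need not be jointly measurable.
\<close>

definition pair_cylinder ::
    "real \<Rightarrow> (real \<Rightarrow> real \<Rightarrow> complex) \<Rightarrow> (real \<times> real \<Rightarrow> real) \<Rightarrow> complex" where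
  "pair_cylinder T w \<phi> =
     (LINT t:{0<..<T}|lebesgue. (LINT x:{0..2*pi}|lebesgue. \<phi> (t, x) *\<^sub>R w t x))"

definition has_weak_time_deriv ::
    "real \<Rightarrow> (real \<Rightarrow> real \<Rightarrow> complex) \<Rightarrow> (real \<Rightarrow> real \<Rightarrow> complex) \<Rightarrow> bool" where
  "has_weak_time_deriv T u v \<longleftrightarrow>
     (\<forall>\<phi>\<in>test_cylinder T. pair_cylinder T u (dt \<phi>) = - pair_cylinder T v \<phi>)"

text \<open>
  \<open>(\<partial>\<^sub>t\<^sup>2 - \<partial>\<^sub>x\<^sup>2) u = F\<close> in the sense of distributions on \<open>(0, T) \<times> \<real>/2\<pi>\<int>\<close>. Only the values
  of \<open>F\<close> on the fundamental domain matter.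
\<close>

definition solves_wave_eq ::
    "real \<Rightarrow> (real \<Rightarrow> real \<Rightarrow> complex) \<Rightarrow> (real \<times> real \<Rightarrow> complex) \<Rightarrow> bool" where
  "solves_wave_eq T u F \<longleftrightarrow>
     (\<forall>\<phi>\<in>test_cylinder T.
        pair_cylinder T u (\<lambda>p. dt (dt \<phi>) p - dx (dx \<phi>) p) =
        (LINT p:{0<..<T} \<times> {0..2*pi}|lebesgue. \<phi> p *\<^sub>R F p))"

definition periodize :: "real set \<Rightarrow> real set" where
  "periodize A = {a + 2 * pi * of_int k | a k. a \<in> A}"

definition L_xi :: "real \<Rightarrow> real set \<Rightarrow> (real \<times> real) set" where
  "L_xi T A = {(t, x). t \<in> {0..T} \<and> x + t \<in> periodize A}"

definition L_eta :: "real \<Rightarrow> real set \<Rightarrow> (real \<times> real) set" where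
  "L_eta T B = {(t, x). t \<in> {0..T} \<and> x - t \<in> periodize B}"

definition observable_symmetric ::
    "real \<Rightarrow> real set \<Rightarrow> real set \<Rightarrow> (real \<times> real) set \<Rightarrow> bool" where
  "observable_symmetric T A B G \<longleftrightarrow> sym_diff (G \<inter> L_xi T A) (G \<inter> L_eta T B) \<in> null_sets lebesgue"

definition translate_mod :: "real set \<Rightarrow> real \<Rightarrow> real set" where
  "translate_mod A s = {(x + s) rmod (2 * pi) | x. x \<in> A}"

definition I_functional ::
    "real set \<Rightarrow> real set \<Rightarrow> (real \<Rightarrow> real \<Rightarrow> complex) \<Rightarrow> (real \<Rightarrow> real \<Rightarrow> complex) \<Rightarrow> real \<Rightarrow> complex" where
  "I_functional A B u v t =
     (LINT x:translate_mod A (- t)|lebesgue. weak_deriv (u t) x + v t x) +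
     (LINT x:translate_mod B t|lebesgue. weak_deriv (u t) x - v t x)"

end

theory Submission
  imports Defs
begin

text \<open>
  For \<open>\<sigma> = 1\<close> and \<open>\<sigma> = - 1\<close> the function \<open>w = \<partial>\<^sub>x u + \<sigma> \<partial>\<^sub>t u\<close> solves
  \<open>(\<partial>\<^sub>t - \<sigma> \<partial>\<^sub>x) w = \<sigma> F\<close> with \<open>F = f \<chi>\<^sub>G\<close>. Testing against \<open>\<theta>(t) \<psi>(x + \<sigma> t)\<close> with \<open>\<psi>\<close>
  smooth and \<open>2\<pi>\<close>-periodic, and letting \<open>\<theta>\<close> tend to the indicator function of \<open>(0, t)\<close>, gives
  \<open>\<integral> \<psi>(x + \<sigma> t) w(t, x) dx - \<integral> \<psi>(x) w(0, x) dx = \<sigma> \<integral>\<integral> \<psi>(x + \<sigma> s) F(s, x) dx ds\<close>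
  with \<open>s\<close> ranging over \<open>(0, t)\<close>.
  Both sides are integrals of \<open>\<psi>\<close> against complex measures, so the identity extends to indicator
  functions of periodic sets. For \<open>A\<close> with \<open>\<sigma> = 1\<close> and \<open>B\<close> with \<open>\<sigma> = - 1\<close> the sum of the right-hand
  sides is the integral of \<open>F\<close> against the difference of the indicators of \<open>L_xi T A\<close> and
  \<open>L_eta T B\<close>, which vanishes almost everywhere on \<open>G\<close> by observable symmetry.
\<close>

section \<open>Smooth functions of one variable\<close>

text \<open>The slices of w are only continuous in the mean and need not be jointly measurable, so
  the equation cannot be integrated along characteristics by a change of variables. The product
  \<theta>(t) \<psi>(x + \<sigma> t) avoids this:
  \<open>\<partial>\<^sub>t - \<sigma> \<partial>\<^sub>x\<close> annihilates its second factor, so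
  only \<theta>' remains, multiplying a continuous function of t alone. A and B are merely Lebesgue
  measurable, and their preimages under x + \<sigma> t are controlled through Borel subsets with
  null remainder; by Fubini the remainder stays null under the shear. For Borel sets the passage
  from smooth \<psi> to indicators rests on arcs (0, b): each is the positivity set of one
  trigonometric function, and together they generate the Borel sets of (0, 2 pi). The same argument
  gives uniqueness of weak derivatives, needed because \<open>weak_deriv\<close> is an arbitrary
  choice. For A and B of full measure both integrals in I run over the whole torus; the time
  derivatives cancel, and testing the weak derivative against the constant 1 shows that the rest
  vanishes.\<close>

primrec C_n :: "nat \<Rightarrow> (real \<Rightarrow> real) \<Rightarrow> bool" where
  "C_n 0 f \<longleftrightarrow> continuous_on UNIV f"
| "C_n (Suc n) f \<longleftrightarrow> (\<exists>f'. (\<forall>x. (f has_real_derivative f' x) (at x)) \<and> C_n n f')"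

text \<open>In \<open>C_n\<close> the derivative is an existential witness instead of
  \<open>deriv\<close>, so closure under sums, products, composition and inverses follows by
  induction from the differentiation rules; \<open>smooth_iff\<close> recovers the form used in
  \<open>test_torus\<close>.\<close>

definition smooth :: "(real \<Rightarrow> real) \<Rightarrow> bool" where
  "smooth f \<longleftrightarrow> (\<forall>n. C_n n f)"

lemma DERIV_imp_continuous_on:
  "(\<And>x. (f has_real_derivative f' x) (at x)) \<Longrightarrow> continuous_on S f"
  by (meson DERIV_isCont continuous_at_imp_continuous_on)

lemma C_n_continuous: "C_n n f \<Longrightarrow> continuous_on UNIV f"
  by (cases n) (auto intro: DERIV_imp_continuous_on)

lemma C_n_mono: "C_n (Suc n) f \<Longrightarrow> C_n n f"
  by (induction n arbitrary: f) (auto intro: DERIV_imp_continuous_on)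

lemma C_n_const: "C_n n (\<lambda>x. c)"
proof (induction n arbitrary: c)
  case (Suc n)
  show ?case using Suc[of 0] by (auto intro!: exI[of _ "\<lambda>x. 0"])
qed (auto)

lemma C_n_add: "C_n n f \<Longrightarrow> C_n n g \<Longrightarrow> C_n n (\<lambda>x. f x + g x)"
proof (induction n arbitrary: f g)
  case (Suc n)
  then obtain f' g' where "\<forall>x. (f has_real_derivative f' x) (at x)" "C_n n f'"
    "\<forall>x. (g has_real_derivative g' x) (at x)" "C_n n g'" by auto
  then have "C_n n (\<lambda>x. f' x + g' x)"
    "\<forall>x. ((\<lambda>x. f x + g x) has_real_derivative f' x + g' x) (at x)"
    by (auto intro: Suc.IH DERIV_add)
  then show ?case by (auto intro!: exI[of _ "\<lambda>x. f' x + g' x"])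
qed (auto intro!: continuous_on_add continuous_on_mult continuous_on_inverse)

lemma C_n_mult: "C_n n f \<Longrightarrow> C_n n g \<Longrightarrow> C_n n (\<lambda>x. f x * g x)"
proof (induction n arbitrary: f g)
  case (Suc n)
  then obtain f' g' where d: "\<forall>x. (f has_real_derivative f' x) (at x)" "C_n n f'"
    "\<forall>x. (g has_real_derivative g' x) (at x)" "C_n n g'" by auto
  have "C_n n (\<lambda>x. f' x * g x + f x * g' x)"
    using C_n_mono[OF Suc.prems(1)] C_n_mono[OF Suc.prems(2)] d by (intro C_n_add Suc.IH)
  moreover have "((\<lambda>x. f x * g x) has_real_derivative f' x * g x + f x * g' x) (at x)" for x
    using d by (auto intro!: derivative_eq_intros)
  ultimately show ?case by (auto intro!: exI[of _ "\<lambda>x. f' x * g x + f x * g' x"])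
qed (auto intro!: continuous_on_add continuous_on_mult continuous_on_inverse)

lemma C_n_compose: "C_n n f \<Longrightarrow> C_n n g \<Longrightarrow> C_n n (\<lambda>x. f (g x))"
proof (induction n arbitrary: f g)
  case 0
  then show ?case using continuous_on_compose2[of UNIV f UNIV g] by simp
next
  case (Suc n)
  then obtain f' g' where d: "\<forall>x. (f has_real_derivative f' x) (at x)" "C_n n f'"
    "\<forall>x. (g has_real_derivative g' x) (at x)" "C_n n g'" by auto
  have "C_n n (\<lambda>x. f' (g x) * g' x)"
    using d C_n_mono[OF Suc.prems(2)] by (intro C_n_mult Suc.IH[of f' g]) auto
  moreover have "((\<lambda>x. f (g x)) has_real_derivative f' (g x) * g' x) (at x)" for x
    using d by (intro DERIV_chain2) auto
  ultimately show ?case by (auto intro!: exI[of _ "\<lambda>x. f' (g x) * g' x"])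
qed

text \<open>The derivative of 1/f is written as a product containing \<open>inverse (f x)\<close>
  twice, so the induction hypothesis for the same \<open>f\<close> at order \<open>n\<close>
  suffices.\<close>

lemma C_n_inverse: "C_n n f \<Longrightarrow> (\<And>x. f x \<noteq> 0) \<Longrightarrow> C_n n (\<lambda>x. inverse (f x))"
proof (induction n)
  case (Suc n)
  then obtain f' where d: "\<forall>x. (f has_real_derivative f' x) (at x)" "C_n n f'" by auto
  have i: "C_n n (\<lambda>x. inverse (f x))" using Suc C_n_mono by blast
  have "C_n n (\<lambda>x. -1 * (inverse (f x) * f' x * inverse (f x)))"
    using d i by (intro C_n_mult C_n_const)
  moreover have "((\<lambda>x. inverse (f x)) has_real_derivative -1 * (inverse (f x) * f' x * inverse (f x))) (at x)" for x
    using DERIV_inverse'[OF d(1)[rule_format, of x]] Suc.prems by simp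
  ultimately show ?case unfolding C_n.simps by (intro exI conjI allI)
qed (auto intro!: continuous_on_add continuous_on_mult continuous_on_inverse)

lemma smooth_const: "smooth (\<lambda>x. c)"
  by (simp add: smooth_def C_n_const)

lemma smooth_add: "smooth f \<Longrightarrow> smooth g \<Longrightarrow> smooth (\<lambda>x. f x + g x)"
  unfolding smooth_def by (intro allI C_n_add) auto

lemma smooth_mult: "smooth f \<Longrightarrow> smooth g \<Longrightarrow> smooth (\<lambda>x. f x * g x)"
  unfolding smooth_def by (intro allI C_n_mult) auto

lemma smooth_compose: "smooth f \<Longrightarrow> smooth g \<Longrightarrow> smooth (\<lambda>x. f (g x))"
  unfolding smooth_def by (rule allI, rule C_n_compose) auto

lemma smooth_inverse: "smooth f \<Longrightarrow> (\<And>x. f x \<noteq> 0) \<Longrightarrow> smooth (\<lambda>x. inverse (f x))"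
  unfolding smooth_def by (intro allI C_n_inverse) auto

lemma smooth_ident: "smooth (\<lambda>x. x)"
proof -
  have "C_n n (\<lambda>x. x)" for n
    by (cases n) (auto intro!: exI[of _ "\<lambda>x. 1"] C_n_const)
  then show ?thesis by (simp add: smooth_def)
qed

lemma smooth_diff: "smooth f \<Longrightarrow> smooth g \<Longrightarrow> smooth (\<lambda>x. f x - g x)"
  using smooth_add[OF _ smooth_mult[OF smooth_const[of "-1"]], of f g] by simp

lemma smooth_cos: "smooth cos"
proof -
  have "C_n n sin \<and> C_n n cos" for n
  proof (induction n)
    case 0
    show ?case by (simp add: continuous_on_sin continuous_on_cos)
  next
    case (Suc n)
    have "C_n n (\<lambda>x. -1 * sin x)" using Suc by (intro C_n_mult C_n_const) auto
    moreover have "\<forall>x::real. (cos has_real_derivative -1 * sin x) (at x)"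
      "\<forall>x::real. (sin has_real_derivative cos x) (at x)"
      by (auto intro!: derivative_eq_intros)
    ultimately show ?case using Suc by (metis C_n.simps(2))
  qed
  then show ?thesis by (auto simp: smooth_def)
qed

lemma smooth_has_deriv: "smooth f \<Longrightarrow> (f has_real_derivative deriv f x) (at x)"
  unfolding smooth_def by (metis C_n.simps(2) DERIV_imp_deriv)

lemma smooth_deriv: "smooth f \<Longrightarrow> smooth (deriv f)"
proof -
  assume f: "smooth f"
  have "C_n n (deriv f)" for n
  proof -
    obtain f' where "\<forall>x. (f has_real_derivative f' x) (at x)" "C_n n f'"
      using f unfolding smooth_def by (metis C_n.simps(2))
    moreover from this have "deriv f = f'" by (auto intro: DERIV_imp_deriv)
    ultimately show ?thesis by simp
  qed
  then show ?thesis by (simp add: smooth_def)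
qed

lemma smooth_continuous: "smooth f \<Longrightarrow> continuous_on S f"
  unfolding smooth_def using C_n_continuous continuous_on_subset by blast

text \<open>The backward direction treats all iterated derivatives at once, since the induction on
  the order passes from one iterate to the next.\<close>

lemma smooth_iff: "smooth f \<longleftrightarrow> (\<forall>n x. ((deriv ^^ n) f) differentiable (at x))"
proof
  assume f: "smooth f"
  have "smooth ((deriv ^^ n) f)" for n
    by (induction n) (auto simp: f smooth_deriv)
  then show "\<forall>n x. ((deriv ^^ n) f) differentiable (at x)"
    using smooth_has_deriv real_differentiable_def by blast
next
  assume f: "\<forall>n x. ((deriv ^^ n) f) differentiable (at x)"
  have d: "((deriv ^^ n) f has_real_derivative (deriv ^^ Suc n) f x) (at x)" for n x
    using f[rule_format, of n x] by (simp add: DERIV_deriv_iff_real_differentiable)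
  have "C_n k ((deriv ^^ n) f)" for k n
  proof (induction k arbitrary: n)
    case 0
    show ?case using d by (simp, blast intro: DERIV_imp_continuous_on)
  next
    case (Suc k)
    show ?case using d Suc by (auto intro!: exI[of _ "(deriv ^^ Suc n) f"] simp del: funpow.simps)
  qed
  from this[of _ 0] show "smooth f" by (simp add: smooth_def)
qed

section \<open>Flat exponentials, a bump function and a smooth step\<close>

definition flat_exp :: "real poly \<Rightarrow> real \<Rightarrow> real" where
  "flat_exp p x = (if x \<le> 0 then 0 else poly p (1 / x) * exp (- (1 / x)))"

lemma poly_mult_exp_tendsto_0: "((\<lambda>z. poly p z * exp (- z)) \<longlongrightarrow> (0::real)) at_top"
proof -
  have "((\<lambda>z. \<Sum>i\<le>degree p. coeff p i * (z ^ i / exp z)) \<longlongrightarrow> (\<Sum>i\<le>degree p. coeff p i * 0)) at_top"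
    by (intro tendsto_intros tendsto_power_div_exp_0)
  then show ?thesis
    by (simp add: poly_altdef exp_minus sum_distrib_right divide_inverse mult.assoc)
qed

text \<open>With z = 1/x one has dz/dx = - z^2, so p(z) exp(-z) has derivative z^2 (p - p')(z)
  exp(-z). The family is closed under differentiation, which gives smoothness by induction without
  formulas for higher derivatives. At 0 both one-sided difference quotients tend to 0.\<close>

lemma flat_exp_deriv:
  "(flat_exp p has_real_derivative flat_exp (monom 1 2 * (p - pderiv p)) x) (at x)"
proof (cases x "0::real" rule: linorder_cases)
  case less
  have "((\<lambda>x. 0) has_real_derivative 0) (at x)" by simp
  moreover have "\<forall>\<^sub>F y in nhds x. flat_exp p y = 0"
    using eventually_nhds_in_open[of "{..<0}" x] less
    by (auto simp: flat_exp_def elim!: eventually_mono)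
  ultimately have "(flat_exp p has_real_derivative 0) (at x)"
    by (subst DERIV_cong_ev[OF refl _ refl]) auto
  then show ?thesis using less by (simp add: flat_exp_def)
next
  case equal
  have "((\<lambda>h. flat_exp p h / h) \<longlongrightarrow> 0) (at_right 0)"
  proof (rule Lim_transform_eventually)
    \<comment> \<open>\<open>pCons 0 p\<close> is the polynomial z p(z): with z = 1/h, dividing
      \<open>flat_exp p h\<close> by h multiplies it by z.\<close>
    show "((\<lambda>h. poly (pCons 0 p) (inverse h) * exp (- inverse h)) \<longlongrightarrow> (0::real)) (at_right 0)"
      by (rule filterlim_compose[OF poly_mult_exp_tendsto_0 filterlim_inverse_at_top_right])
    show "\<forall>\<^sub>F h in at_right 0. poly (pCons 0 p) (inverse h) * exp (- inverse h) = flat_exp p h / h"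
      by (auto simp: eventually_at_filter flat_exp_def field_simps)
  qed
  moreover have "((\<lambda>h. flat_exp p h / h) \<longlongrightarrow> 0) (at_left 0)"
    by (rule Lim_transform_eventually[OF tendsto_const])
       (auto simp: eventually_at_filter flat_exp_def)
  ultimately have "((\<lambda>h. flat_exp p h / h) \<longlongrightarrow> 0) (at 0)"
    by (simp add: filterlim_split_at)
  then show ?thesis using equal by (simp add: DERIV_def) (simp add: flat_exp_def)
next
  case greater
  have "((\<lambda>x. poly p (1/x) * exp (- (1/x))) has_real_derivative
      flat_exp (monom 1 2 * (p - pderiv p)) x) (at x)"
    using greater by (auto intro!: derivative_eq_intros poly_DERIV[THEN DERIV_chain2]
      simp: flat_exp_def poly_monom field_simps power2_eq_square)
  moreover have "\<forall>\<^sub>F y in nhds x. flat_exp p y = poly p (1/y) * exp (- (1/y))"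
    using eventually_nhds_in_open[of "{0<..}" x] greater
    by (auto simp: flat_exp_def elim!: eventually_mono)
  ultimately show ?thesis
    by (subst DERIV_cong_ev[OF refl _ refl]) auto
qed

definition bump :: "real \<Rightarrow> real" where
  "bump x = (if x \<le> 0 then 0 else exp (- (1 / x)))"

lemma smooth_bump: "smooth bump"
proof -
  have "C_n n (flat_exp p)" for n p
  proof (induction n arbitrary: p)
    case 0
    show ?case using flat_exp_deriv by (simp, blast intro: DERIV_imp_continuous_on)
  next
    case (Suc n)
    then show ?case using flat_exp_deriv by auto
  qed
  then have "smooth (flat_exp 1)" unfolding smooth_def by blast
  moreover have "bump = flat_exp 1" by (intro ext) (auto simp: bump_def flat_exp_def)
  ultimately show ?thesis by (simp only:)
qed

lemma bump_nonneg: "0 \<le> bump x" and bump_le_1: "bump x \<le> 1" and bump_pos_iff: "0 < bump x \<longleftrightarrow> 0 < x"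
  by (auto simp: bump_def)

text \<open>For y > 0 the values exp(-1/(n y)) tend to 1. Composed with a smooth function, this
  approximates the indicator of the open set where that function is positive.\<close>

lemma bump_tendsto_indicator:
  "(\<lambda>n. bump (real n * y)) \<longlonglongrightarrow> indicator {0<..} y"
proof (cases "y > 0")
  case True
  have "(\<lambda>n. exp (- (inverse (real n) * inverse y))) \<longlonglongrightarrow> exp (- (0 * inverse y))"
    by (intro tendsto_intros LIMSEQ_inverse_real_of_nat lim_inverse_n)
  then have "(\<lambda>n. exp (- (inverse (real n) * inverse y))) \<longlonglongrightarrow> indicator {0<..} y"
    using True by simp
  then show ?thesis
  proof (rule Lim_transform_eventually)
    show "\<forall>\<^sub>F n in sequentially. exp (- (inverse (real n) * inverse y)) = bump (real n * y)"
      using eventually_gt_at_top[of 0]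
      by eventually_elim (use True in \<open>auto simp: bump_def inverse_eq_divide mult_le_0_iff\<close>)
  qed
next
  case False
  then have "real n * y \<le> 0" for n by (simp add: mult_nonneg_nonpos)
  then show ?thesis using False by (simp add: bump_def)
qed

text \<open>The standard smooth transition from 0 on the nonpositive axis to 1 on [1, infinity). The
  denominator is positive because x and 1 - x are never both nonpositive.\<close>

definition smooth_step :: "real \<Rightarrow> real" where
  "smooth_step x = bump x * inverse (bump x + bump (1 - x))"

lemma bump_sum_pos: "0 < bump x + bump (1 - x)"
  using bump_pos_iff[of x] bump_pos_iff[of "1 - x"] bump_nonneg[of x] bump_nonneg[of "1 - x"]
  by (cases "x > 0") linarith+

lemma smooth_smooth_step: "smooth smooth_step"
proof -
  have "smooth (\<lambda>x. bump (1 - x))"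
    by (rule smooth_compose[OF smooth_bump smooth_diff[OF smooth_const smooth_ident]])
  moreover have "bump x + bump (1 - x) \<noteq> 0" for x
    using bump_sum_pos[of x] by simp
  ultimately have "smooth (\<lambda>x. bump x * inverse (bump x + bump (1 - x)))"
    using smooth_bump by (intro smooth_mult smooth_inverse smooth_add)
  then show ?thesis by (simp only: smooth_step_def[abs_def])
qed

lemma smooth_step_eq_0: "x \<le> 0 \<Longrightarrow> smooth_step x = 0"
  by (simp add: smooth_step_def bump_def)

lemma smooth_step_eq_1: "x \<ge> 1 \<Longrightarrow> smooth_step x = 1"
  using bump_sum_pos[of x] by (simp add: smooth_step_def bump_def)

lemma smooth_step_nonneg: "0 \<le> smooth_step x" and smooth_step_le_1: "smooth_step x \<le> 1"
  using bump_sum_pos[of x] bump_nonneg[of x] bump_nonneg[of "1 - x"]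
  by (auto simp: smooth_step_def field_simps)

section \<open>Test functions on the cylinder\<close>

lemma test_torus_iff: "\<psi> \<in> test_torus \<longleftrightarrow> periodic_2pi \<psi> \<and> smooth \<psi>"
  by (simp add: test_torus_def smooth_iff)

lemma periodic_2pi_of_int:
  assumes "periodic_2pi g"
  shows "g (x + 2 * pi * of_int k) = g x"
proof -
  have nat: "g (x + 2 * pi * real n) = g x" for n x
  proof (induction n)
    case (Suc n)
    have "g (x + 2 * pi * real (Suc n)) = g ((x + 2 * pi * real n) + 2 * pi)"
      by (simp add: algebra_simps)
    then show ?case using assms Suc unfolding periodic_2pi_def by simp
  qed simp
  show ?thesis
  proof (cases "k \<ge> 0")
    case True
    then show ?thesis using nat[of x "nat k"] by simp
  next
    case False
    then show ?thesis using nat[of "x + 2 * pi * of_int k" "nat (- k)"] by simp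
  qed
qed

lemma bounded_periodic:
  fixes g :: "real \<Rightarrow> real"
  assumes "continuous_on UNIV g" "periodic_2pi g"
  obtains C where "C > 0" "\<And>x. \<bar>g x\<bar> \<le> C"
proof -
  have "bounded (g ` {0..2*pi})"
    using compact_continuous_image[OF continuous_on_subset[OF assms(1)]] compact_imp_bounded by blast
  then obtain C where C: "C > 0" "\<And>x. x \<in> {0..2*pi} \<Longrightarrow> \<bar>g x\<bar> \<le> C"
    unfolding bounded_pos by auto
  have "\<bar>g x\<bar> \<le> C" for x
  proof -
    have "x rmod (2*pi) \<in> {0..2*pi}" using rmod_nonneg[of "2*pi" x] rmod_le[of "2*pi" x] by auto
    moreover have "g x = g (x rmod (2*pi))"
      using periodic_2pi_of_int[OF assms(2), of x "- \<lfloor>x / \<bar>2 * pi\<bar>\<rfloor>"] by (simp add: rmod_def)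
    ultimately show ?thesis using C by metis
  qed
  with C show ?thesis using that by blast
qed

text \<open>The factor with \<open>\<psi>\<close> is constant on the lines x + \<sigma> t = const,
  so \<open>\<partial>\<^sub>t - \<sigma> \<partial>\<^sub>x\<close> differentiates only
  \<open>\<theta>\<close>.\<close>

definition travelling_wave :: "real \<Rightarrow> (real \<Rightarrow> real) \<Rightarrow> (real \<Rightarrow> real) \<Rightarrow> real \<times> real \<Rightarrow> real" where
  "travelling_wave \<sigma> \<theta> \<psi> = (\<lambda>(t, x). \<theta> t * \<psi> (x + \<sigma> * t))"

lemma C_k_continuous: "C_k k \<phi> \<Longrightarrow> continuous_on UNIV \<phi>"
  by (cases k) auto

lemma C_k_add:
  "C_k k f \<Longrightarrow> C_k k g \<Longrightarrow> C_k k (\<lambda>p. f p + g p)"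
proof (induction k arbitrary: f g)
  case 0
  then show ?case by (simp add: continuous_on_add)
next
  case (Suc k)
  have df: "(\<lambda>s. f (s, x)) differentiable (at t)" "(\<lambda>y. f (t, y)) differentiable (at x)"
   and dg: "(\<lambda>s. g (s, x)) differentiable (at t)" "(\<lambda>y. g (t, y)) differentiable (at x)" for t x
    using Suc.prems by auto
  have "dt (\<lambda>p. f p + g p) = (\<lambda>p. dt f p + dt g p)"
    unfolding dt_def fun_eq_iff split_paired_all case_prod_conv
    using DERIV_imp_deriv[OF DERIV_add[OF df(1)[folded DERIV_deriv_iff_real_differentiable]
      dg(1)[folded DERIV_deriv_iff_real_differentiable]]] by auto
  moreover have "dx (\<lambda>p. f p + g p) = (\<lambda>p. dx f p + dx g p)"
    unfolding dx_def fun_eq_iff split_paired_all case_prod_conv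
    using DERIV_imp_deriv[OF DERIV_add[OF df(2)[folded DERIV_deriv_iff_real_differentiable]
      dg(2)[folded DERIV_deriv_iff_real_differentiable]]] by auto
  ultimately show ?case using Suc by (simp add: continuous_on_add)
qed

text \<open>The factor \<sigma> from the chain rule is absorbed into the time profile, so both
  derivatives are again sums of travelling waves; this makes the induction in
  \<open>C_k_travelling_wave\<close> close.\<close>

lemma travelling_wave_has_deriv:
  assumes "smooth \<theta>" "smooth \<psi>"
  shows "((\<lambda>s. travelling_wave \<sigma> \<theta> \<psi> (s, x)) has_real_derivative
      travelling_wave \<sigma> (deriv \<theta>) \<psi> (t, x) + travelling_wave \<sigma> (\<lambda>t. \<sigma> * \<theta> t) (deriv \<psi>) (t, x)) (at t)"
    and "((\<lambda>y. travelling_wave \<sigma> \<theta> \<psi> (t, y)) has_real_derivative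
      travelling_wave \<sigma> \<theta> (deriv \<psi>) (t, x)) (at x)"
proof -
  have "((\<lambda>s. \<psi> (x + \<sigma> * s)) has_real_derivative deriv \<psi> (x + \<sigma> * t) * \<sigma>) (at t)"
    by (rule DERIV_chain2[OF smooth_has_deriv[OF assms(2)]]) (auto intro!: derivative_eq_intros)
  from DERIV_mult[OF smooth_has_deriv[OF assms(1), of t] this]
  show "((\<lambda>s. travelling_wave \<sigma> \<theta> \<psi> (s, x)) has_real_derivative
      travelling_wave \<sigma> (deriv \<theta>) \<psi> (t, x) + travelling_wave \<sigma> (\<lambda>t. \<sigma> * \<theta> t) (deriv \<psi>) (t, x)) (at t)"
    by (simp add: travelling_wave_def algebra_simps)
  have "((\<lambda>y. \<psi> (y + \<sigma> * t)) has_real_derivative deriv \<psi> (x + \<sigma> * t) * 1) (at x)"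
    by (rule DERIV_chain2[OF smooth_has_deriv[OF assms(2)]]) (auto intro!: derivative_eq_intros)
  from DERIV_cmult[OF this, of "\<theta> t"]
  show "((\<lambda>y. travelling_wave \<sigma> \<theta> \<psi> (t, y)) has_real_derivative
      travelling_wave \<sigma> \<theta> (deriv \<psi>) (t, x)) (at x)"
    by (simp add: travelling_wave_def)
qed

lemma travelling_wave_derivs:
  assumes "smooth \<theta>" "smooth \<psi>"
  shows "dt (travelling_wave \<sigma> \<theta> \<psi>) =
      (\<lambda>p. travelling_wave \<sigma> (deriv \<theta>) \<psi> p + travelling_wave \<sigma> (\<lambda>t. \<sigma> * \<theta> t) (deriv \<psi>) p)"
    and "dx (travelling_wave \<sigma> \<theta> \<psi>) = travelling_wave \<sigma> \<theta> (deriv \<psi>)"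
  using travelling_wave_has_deriv[OF assms, THEN DERIV_imp_deriv] by (auto simp: dt_def dx_def)

lemma continuous_travelling_wave:
  assumes "continuous_on UNIV \<theta>" "continuous_on UNIV \<psi>"
  shows "continuous_on UNIV (travelling_wave \<sigma> \<theta> \<psi>)"
proof -
  have "continuous_on UNIV (\<lambda>p::real \<times> real. \<theta> (fst p))"
    by (rule continuous_on_compose2[OF assms(1)]) (auto intro: continuous_on_fst)
  moreover have "continuous_on UNIV (\<lambda>p::real \<times> real. \<psi> (snd p + \<sigma> * fst p))"
    by (rule continuous_on_compose2[OF assms(2)]) (auto intro!: continuous_intros)
  ultimately show ?thesis
    unfolding travelling_wave_def case_prod_unfold by (rule continuous_on_mult)
qed

lemma C_k_travelling_wave:
  assumes "smooth \<theta>" "smooth \<psi>"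
  shows "C_k k (travelling_wave \<sigma> \<theta> \<psi>)"
  using assms
proof (induction k arbitrary: \<theta> \<psi>)
  case 0
  then show ?case by (simp add: continuous_travelling_wave smooth_continuous)
next
  case (Suc k)
  have "smooth (\<lambda>t. \<sigma> * \<theta> t)" using Suc by (intro smooth_mult smooth_const)
  then have "C_k k (dt (travelling_wave \<sigma> \<theta> \<psi>))" "C_k k (dx (travelling_wave \<sigma> \<theta> \<psi>))"
    using Suc by (simp_all add: travelling_wave_derivs C_k_add smooth_deriv)
  moreover have "continuous_on UNIV (travelling_wave \<sigma> \<theta> \<psi>)"
    using Suc by (simp add: continuous_travelling_wave smooth_continuous)
  ultimately show ?case
    using travelling_wave_has_deriv[OF Suc.prems]
    unfolding C_k.simps real_differentiable_def by blast
qed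

text \<open>Supplies the cancellation of the mixed terms in \<open>weak_transport_equation\<close>.
  Both orders of differentiation give the same explicit sum of two travelling waves.\<close>

lemma travelling_wave_mixed_derivs:
  assumes "smooth \<theta>" "smooth \<psi>"
  shows "dt (dx (travelling_wave \<sigma> \<theta> \<psi>)) = dx (dt (travelling_wave \<sigma> \<theta> \<psi>))"
proof -
  have s: "smooth (\<lambda>t. \<sigma> * \<theta> t)" using assms by (intro smooth_mult smooth_const)
  have "dx (\<lambda>p. travelling_wave \<sigma> (deriv \<theta>) \<psi> p + travelling_wave \<sigma> (\<lambda>t. \<sigma> * \<theta> t) (deriv \<psi>) p) =
    (\<lambda>p. travelling_wave \<sigma> (deriv \<theta>) (deriv \<psi>) p + travelling_wave \<sigma> (\<lambda>t. \<sigma> * \<theta> t) (deriv (deriv \<psi>)) p)"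
    unfolding dx_def fun_eq_iff split_paired_all case_prod_conv
    using DERIV_add[OF travelling_wave_has_deriv(2)[OF smooth_deriv[OF assms(1)] assms(2)]
      travelling_wave_has_deriv(2)[OF s smooth_deriv[OF assms(2)]], THEN DERIV_imp_deriv]
    by auto
  then show ?thesis using assms s by (simp add: travelling_wave_derivs smooth_deriv)
qed

lemma travelling_wave_in_test_cylinder:
  assumes "smooth \<theta>" "\<psi> \<in> test_torus" "0 < a" "b < T" "\<And>t. \<theta> t \<noteq> 0 \<Longrightarrow> a \<le> t \<and> t \<le> b"
  shows "travelling_wave \<sigma> \<theta> \<psi> \<in> test_cylinder T"
proof -
  have "\<psi> (x + 2 * pi + \<sigma> * t) = \<psi> (x + \<sigma> * t)" for x t
  proof -
    have "\<psi> ((x + \<sigma> * t) + 2 * pi) = \<psi> (x + \<sigma> * t)"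
      using assms(2) by (simp only: test_torus_iff periodic_2pi_def)
    then show ?thesis by (simp only: ac_simps)
  qed
  then have "periodic_2pi (\<lambda>x. travelling_wave \<sigma> \<theta> \<psi> (t, x))" for t
    by (simp add: periodic_2pi_def travelling_wave_def)
  moreover have "\<forall>t x. travelling_wave \<sigma> \<theta> \<psi> (t, x) \<noteq> 0 \<longrightarrow> a \<le> t \<and> t \<le> b"
    using assms(5) by (simp add: travelling_wave_def)
  moreover have "\<forall>k. C_k k (travelling_wave \<sigma> \<theta> \<psi>)"
    using assms(1,2) by (simp add: test_torus_iff C_k_travelling_wave)
  ultimately show ?thesis using assms(3,4) unfolding test_cylinder_def by blast
qed

lemma test_cylinder_continuous: "\<phi> \<in> test_cylinder T \<Longrightarrow> continuous_on UNIV \<phi>"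
  using C_k_continuous by (auto simp: test_cylinder_def)

lemma test_cylinder_C_k: "\<phi> \<in> test_cylinder T \<Longrightarrow> C_k k \<phi>"
  by (simp add: test_cylinder_def)

text \<open>This allows the weak identities to be applied to derivatives of a test function. The
  complement of [a, b] is open and \<open>\<phi>\<close> vanishes there, so the same a and b bound
  the support of both derivatives.\<close>

lemma test_cylinder_dt: "dt \<phi> \<in> test_cylinder T"
  and test_cylinder_dx: "dx \<phi> \<in> test_cylinder T" if \<phi>: "\<phi> \<in> test_cylinder T"
proof -
  have per: "\<phi> (t, x + 2 * pi) = \<phi> (t, x)" for t x
    using \<phi> by (auto simp: test_cylinder_def periodic_2pi_def)
  have smooth: "C_k k (dt \<phi>)" "C_k k (dx \<phi>)" for k
    using test_cylinder_C_k[OF \<phi>, of "Suc k"] by auto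
  obtain a b where ab: "0 < a" "b < T" "\<And>t x. \<phi> (t, x) \<noteq> 0 \<Longrightarrow> a \<le> t \<and> t \<le> b"
    using \<phi> unfolding test_cylinder_def by blast
  have 1: "dt \<phi> (t, x + 2 * pi) = dt \<phi> (t, x)" for t x
    by (simp add: dt_def per)
  have "deriv (\<lambda>y. \<phi> (t, y)) (x + 2 * pi) = deriv (\<lambda>y. \<phi> (t, y)) x" for t x
  proof (rule DERIV_imp_deriv)
    have "((\<lambda>y. \<phi> (t, y + - (2 * pi))) has_real_derivative deriv (\<lambda>y. \<phi> (t, y)) x) (at (x + 2 * pi))"
      using test_cylinder_C_k[OF \<phi>, of 1]
      by (subst DERIV_shift) (simp add: DERIV_deriv_iff_real_differentiable)
    moreover have "\<phi> (t, y + - (2 * pi)) = \<phi> (t, y)" for y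
      using per[of t "y - 2 * pi"] by simp
    ultimately show "((\<lambda>y. \<phi> (t, y)) has_real_derivative deriv (\<lambda>y. \<phi> (t, y)) x) (at (x + 2 * pi))"
      by simp
  qed
  then have 2: "dx \<phi> (t, x + 2 * pi) = dx \<phi> (t, x)" for t x
    by (simp add: dx_def)
  have 3: "dx \<phi> (t, x) = 0" "dt \<phi> (t, x) = 0" if t: "\<not> (a \<le> t \<and> t \<le> b)" for t x
  proof -
    have z: "\<phi> (s, y) = 0" if "s \<in> - {a..b}" for s y using ab(3)[of s y] that by auto
    have "(\<lambda>y. \<phi> (t, y)) = (\<lambda>y. 0)" using t z by auto
    then show "dx \<phi> (t, x) = 0" by (simp add: dx_def)
    have "\<forall>\<^sub>F s in nhds t. \<phi> (s, x) = 0"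
      using eventually_mono[OF eventually_nhds_in_open[of "- {a..b}" t]] t z
      by (simp add: open_Compl)
    then have "((\<lambda>s. \<phi> (s, x)) has_real_derivative 0) (at t)"
      by (subst DERIV_cong_ev[OF refl _ refl]) auto
    then show "dt \<phi> (t, x) = 0" by (simp add: dt_def DERIV_imp_deriv)
  qed
  have "\<exists>a b. 0 < a \<and> b < T \<and> (\<forall>t x. dt \<phi> (t, x) \<noteq> 0 \<longrightarrow> a \<le> t \<and> t \<le> b)"
       "\<exists>a b. 0 < a \<and> b < T \<and> (\<forall>t x. dx \<phi> (t, x) \<noteq> 0 \<longrightarrow> a \<le> t \<and> t \<le> b)"
    using ab 3 by blast+
  then show "dt \<phi> \<in> test_cylinder T" "dx \<phi> \<in> test_cylinder T"
    using 1 2 smooth by (auto simp: test_cylinder_def periodic_2pi_def)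
qed

text \<open>Lets the weak derivative in x be applied in each time slice separately.\<close>

lemma test_cylinder_slice:
  assumes "\<phi> \<in> test_cylinder T"
  shows "(\<lambda>x. \<phi> (t, x)) \<in> test_torus"
proof -
  have "C_k k \<phi> \<Longrightarrow> C_n k (\<lambda>x. \<phi> (t, x))" for k \<phi>
  proof (induction k arbitrary: \<phi>)
    case 0
    then show ?case
      using continuous_on_compose2[of UNIV \<phi> UNIV "\<lambda>x. (t, x)"]
      by (simp add: continuous_on_Pair)
  next
    case (Suc k)
    have "((\<lambda>x. \<phi> (t, x)) has_real_derivative dx \<phi> (t, x)) (at x)" for x
      using Suc.prems by (simp add: dx_def DERIV_deriv_iff_real_differentiable)
    moreover have "C_n k (\<lambda>x. dx \<phi> (t, x))" using Suc by simp
    ultimately show ?case by (auto intro!: exI[of _ "\<lambda>x. dx \<phi> (t, x)"])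
  qed
  then show ?thesis using assms by (auto simp: test_torus_iff test_cylinder_def smooth_def)
qed

lemma deriv_slice: "deriv (\<lambda>x. \<phi> (t, x)) = (\<lambda>x. dx \<phi> (t, x))"
  by (simp add: dx_def fun_eq_iff)

section \<open>A monotone class argument on the torus\<close>

lemma periodize_iff:
  assumes "A \<subseteq> {0..<2*pi}"
  shows "y \<in> periodize A \<longleftrightarrow> y rmod (2 * pi) \<in> A"
proof
  assume "y \<in> periodize A"
  then obtain a k where a: "a \<in> A" "y = a + of_int k * (2 * pi)" by (auto simp: periodize_def mult.commute)
  then have "y rmod (2 * pi) = a" using assms by (intro rmod_unique) auto
  then show "y rmod (2 * pi) \<in> A" using a by simp
next
  assume y: "y rmod (2 * pi) \<in> A"
  have "y = y rmod (2 * pi) + 2 * pi * of_int \<lfloor>y / \<bar>2 * pi\<bar>\<rfloor>" by (simp add: rmod_def)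
  then show "y \<in> periodize A" using y unfolding periodize_def by blast
qed

lemma periodize_eq_UN: "periodize A = (\<Union>k::int. (+) (2 * pi * of_int k) ` A)"
  by (auto simp: periodize_def algebra_simps)

text \<open>
  The difference of the two sides of the integrated transport identity combines integrals over
  different measure spaces; the monotone class argument only needs the following two properties.
\<close>

definition bounded_convergence_functional :: "((real \<Rightarrow> real) \<Rightarrow> complex) \<Rightarrow> bool" where
  "bounded_convergence_functional \<Lambda> \<longleftrightarrow>
     (\<forall>f g. f \<in> borel_measurable borel \<and> g \<in> borel_measurable borel \<and>
        bounded (range f) \<and> bounded (range g) \<longrightarrow> \<Lambda> (\<lambda>x. f x - g x) = \<Lambda> f - \<Lambda> g) \<and>
     (\<forall>F f C. (\<forall>n. F n \<in> borel_measurable borel) \<and> (\<forall>n x. \<bar>F n x\<bar> \<le> C) \<and>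
        (\<forall>x. (\<lambda>n. F n x) \<longlonglongrightarrow> f x) \<longrightarrow> (\<lambda>n. \<Lambda> (F n)) \<longlonglongrightarrow> \<Lambda> f)"

lemma bcf_diff:
  assumes "bounded_convergence_functional \<Lambda>" "f \<in> borel_measurable borel" "g \<in> borel_measurable borel"
    "bounded (range f)" "bounded (range g)"
  shows "\<Lambda> (\<lambda>x. f x - g x) = \<Lambda> f - \<Lambda> g"
  using assms unfolding bounded_convergence_functional_def by blast

lemma bcf_limit:
  assumes "bounded_convergence_functional \<Lambda>" "\<And>n. F n \<in> borel_measurable borel" "\<And>n x. \<bar>F n x\<bar> \<le> C"
    "\<And>x. (\<lambda>n. F n x) \<longlonglongrightarrow> f x"
  shows "(\<lambda>n. \<Lambda> (F n)) \<longlonglongrightarrow> \<Lambda> f"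
  using assms unfolding bounded_convergence_functional_def by blast

lemma bcf_zero: "bounded_convergence_functional \<Lambda> \<Longrightarrow> \<Lambda> (\<lambda>x. 0) = 0"
  using bcf_diff[of \<Lambda> "\<lambda>x. 0" "\<lambda>x. 0"] by simp

lemma bcf_add:
  assumes "bounded_convergence_functional \<Lambda>" "f \<in> borel_measurable borel" "g \<in> borel_measurable borel"
    "bounded (range f)" "bounded (range g)"
  shows "\<Lambda> (\<lambda>x. f x + g x) = \<Lambda> f + \<Lambda> g"
proof -
  have "bounded (range (\<lambda>x. - g x))" using assms(5) bounded_uminus[of "range g"] by (simp add: image_image)
  then have "\<Lambda> (\<lambda>x. f x - (0 - g x)) = \<Lambda> f - \<Lambda> (\<lambda>x. 0 - g x)"
    using assms by (intro bcf_diff[OF assms(1)]) auto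
  moreover have "\<Lambda> (\<lambda>x. 0 - g x) = \<Lambda> (\<lambda>x. 0) - \<Lambda> g"
    using assms by (intro bcf_diff[OF assms(1)]) auto
  ultimately show ?thesis using bcf_zero[OF assms(1)] by simp
qed

lemma bounded_range_indicator: "bounded (range (indicator A :: 'a \<Rightarrow> real))"
  by (rule boundedI[of _ 1]) (auto simp: indicator_def)

text \<open>The functional integrates g against the pushforward under \<open>\<tau>\<close> of the
  complex measure with density \<open>\<mu>\<close>. Later \<open>\<tau>\<close> is a translation of
  the line or a shear of the plane. The limit property is dominated convergence with majorant C
  |\<mu>|.\<close>

lemma bcf_integral:
  assumes \<mu>: "integrable M \<mu>" and \<tau>: "\<tau> \<in> borel_measurable M"
  shows "bounded_convergence_functional (\<lambda>g. LINT z|M. g (\<tau> z) *\<^sub>R \<mu> z)"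
  unfolding bounded_convergence_functional_def
proof (intro conjI allI impI; elim conjE)
  have int: "integrable M (\<lambda>z. f (\<tau> z) *\<^sub>R \<mu> z)"
    if "f \<in> borel_measurable borel" "bounded (range f)" for f :: "real \<Rightarrow> real"
  proof -
    obtain C where C: "\<And>x. \<bar>f x\<bar> \<le> C" using \<open>bounded (range f)\<close> by (auto simp: bounded_iff)
    show ?thesis
    proof (rule Bochner_Integration.integrable_bound)
      show "integrable M (\<lambda>z. C * norm (\<mu> z))" using \<mu> by simp
      show "(\<lambda>z. f (\<tau> z) *\<^sub>R \<mu> z) \<in> borel_measurable M"
        using measurable_compose[OF \<tau> that(1)] \<mu> by measurable
      show "AE x in M. norm (f (\<tau> x) *\<^sub>R \<mu> x) \<le> norm (C * norm (\<mu> x))"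
      proof (rule AE_I2)
        fix x
        have "\<bar>f (\<tau> x)\<bar> \<le> \<bar>C\<bar>" using C[of "\<tau> x"] by linarith
        then show "norm (f (\<tau> x) *\<^sub>R \<mu> x) \<le> norm (C * norm (\<mu> x))"
          by (simp add: abs_mult mult_right_mono)
      qed
    qed
  qed
  fix f g :: "real \<Rightarrow> real"
  assume "f \<in> borel_measurable borel" "g \<in> borel_measurable borel" "bounded (range f)" "bounded (range g)"
  then show "(LINT z|M. (f (\<tau> z) - g (\<tau> z)) *\<^sub>R \<mu> z) = (LINT z|M. f (\<tau> z) *\<^sub>R \<mu> z) - (LINT z|M. g (\<tau> z) *\<^sub>R \<mu> z)"
    using int by (simp add: scaleR_diff_left)
next
  fix F and f :: "real \<Rightarrow> real" and C
  assume F: "\<forall>n. F n \<in> borel_measurable borel" "\<forall>n x. \<bar>F n x\<bar> \<le> C" "\<forall>x. (\<lambda>n. F n x) \<longlonglongrightarrow> f x"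
  have f: "f \<in> borel_measurable borel"
    by (rule borel_measurable_LIMSEQ_real[of borel F]) (use F in auto)
  show "(\<lambda>n. LINT z|M. F n (\<tau> z) *\<^sub>R \<mu> z) \<longlonglongrightarrow> (LINT z|M. f (\<tau> z) *\<^sub>R \<mu> z)"
  proof (rule integral_dominated_convergence)
    show "(\<lambda>z. f (\<tau> z) *\<^sub>R \<mu> z) \<in> borel_measurable M"
      using measurable_compose[OF \<tau> f] \<mu> by measurable
    show "(\<lambda>z. F n (\<tau> z) *\<^sub>R \<mu> z) \<in> borel_measurable M" for n
      using measurable_compose[OF \<tau> F(1)[rule_format, of n]] \<mu> by measurable
    show "integrable M (\<lambda>z. C * norm (\<mu> z))" using \<mu> by simp
    show "AE z in M. (\<lambda>n. F n (\<tau> z) *\<^sub>R \<mu> z) \<longlonglongrightarrow> f (\<tau> z) *\<^sub>R \<mu> z"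
      by (rule AE_I2, intro tendsto_scaleR tendsto_const) (use F in auto)
    show "AE z in M. norm (F n (\<tau> z) *\<^sub>R \<mu> z) \<le> C * norm (\<mu> z)" for n
      using F by (auto simp: intro!: mult_right_mono)
  qed
qed

lemma bcf_combine:
  assumes "bounded_convergence_functional \<Lambda>\<^sub>1" "bounded_convergence_functional \<Lambda>\<^sub>2"
  shows "bounded_convergence_functional (\<lambda>g. \<Lambda>\<^sub>1 g - c *\<^sub>R \<Lambda>\<^sub>2 g)"
  unfolding bounded_convergence_functional_def
proof (intro conjI allI impI; elim conjE)
  fix f g :: "real \<Rightarrow> real"
  assume "f \<in> borel_measurable borel" "g \<in> borel_measurable borel" "bounded (range f)" "bounded (range g)"
  then show "\<Lambda>\<^sub>1 (\<lambda>x. f x - g x) - c *\<^sub>R \<Lambda>\<^sub>2 (\<lambda>x. f x - g x) = \<Lambda>\<^sub>1 f - c *\<^sub>R \<Lambda>\<^sub>2 f - (\<Lambda>\<^sub>1 g - c *\<^sub>R \<Lambda>\<^sub>2 g)"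
    using bcf_diff[OF assms(1), of f g] bcf_diff[OF assms(2), of f g] by (simp add: scaleR_diff_right)
next
  fix F and f :: "real \<Rightarrow> real" and C
  assume "\<forall>n. F n \<in> borel_measurable borel" "\<forall>n x. \<bar>F n x\<bar> \<le> C" "\<forall>x. (\<lambda>n. F n x) \<longlonglongrightarrow> f x"
  then show "(\<lambda>n. \<Lambda>\<^sub>1 (F n) - c *\<^sub>R \<Lambda>\<^sub>2 (F n)) \<longlonglongrightarrow> \<Lambda>\<^sub>1 f - c *\<^sub>R \<Lambda>\<^sub>2 f"
    by (intro tendsto_intros bcf_limit[OF assms(1), of F C f] bcf_limit[OF assms(2), of F C f]) auto
qed

text \<open>If x is the residue of y, the difference of cosines equals 2 sin(x/2) sin((b - x)/2).
  For 0 < x < 2 pi the first factor is positive, and the second is positive exactly when x < b. At x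
  = 0 the product is 0, which is why the arc is open at its left end.\<close>

lemma cos_arc:
  assumes "0 \<le> b" "b \<le> 2 * pi"
  shows "cos (y - b / 2) - cos (b / 2) > 0 \<longleftrightarrow> y rmod (2 * pi) \<in> {0<..<b}"
proof -
  define x where "x = y rmod (2 * pi)"
  have x: "0 \<le> x" "x < 2 * pi" using rmod_nonneg[of "2*pi" y] rmod_less[of "2*pi" y] by (auto simp: x_def)
  have "y - b / 2 = (x - b / 2) + of_int \<lfloor>y / \<bar>2 * pi\<bar>\<rfloor> * (2 * pi)" by (simp add: x_def rmod_def)
  then have "cos (y - b / 2) = cos (x - b / 2)"
    using cos.plus_of_int[of "x - b/2" "\<lfloor>y / \<bar>2 * pi\<bar>\<rfloor>"] by (simp only: of_real_eq_id id_apply)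
  then have *: "cos (y - b / 2) - cos (b / 2) = 2 * sin (x / 2) * sin ((b - x) / 2)"
    by (simp add: cos_diff_cos diff_divide_distrib add_divide_distrib)
  show ?thesis
  proof (cases "x = 0")
    case True
    then show ?thesis unfolding * by (simp flip: x_def)
  next
    case x0: False
    then have "sin (x / 2) > 0" using x by (intro sin_gt_zero) auto
    moreover have "sin ((b - x) / 2) > 0 \<longleftrightarrow> x < b"
    proof (cases "x < b")
      case True
      then have "sin ((b - x) / 2) > 0" using x assms x0 by (intro sin_gt_zero) simp_all
      then show ?thesis using True by simp
    next
      case False
      then have "sin ((x - b) / 2) \<ge> 0" using x assms by (intro sin_ge_zero) auto
      moreover have "sin ((b - x) / 2) = - sin ((x - b) / 2)"
        using sin_minus[of "(x - b) / 2"] by (simp add: minus_divide_left)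
      ultimately show ?thesis using False by simp
    qed
    ultimately show ?thesis using x0 x unfolding * by (simp add: zero_less_mult_iff flip: x_def)
  qed
qed

text \<open>The arc is the positivity set from \<open>cos_arc\<close>, so its indicator is a
  pointwise limit of smooth periodic functions with values in [0, 1].\<close>

lemma bcf_arc_eq_0:
  assumes \<Lambda>: "bounded_convergence_functional \<Lambda>" "\<And>\<psi>. \<psi> \<in> test_torus \<Longrightarrow> \<Lambda> \<psi> = 0"
    and b: "0 \<le> b" "b \<le> 2 * pi"
  shows "\<Lambda> (indicator (periodize {0<..<b})) = 0"
proof -
  define \<psi> where "\<psi> n y = bump (real n * (cos (y - b / 2) - cos (b / 2)))" for n y
  have \<psi>: "\<psi> n \<in> test_torus" for n
  proof -
    have "smooth (\<lambda>y. cos (y - b / 2))"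
      by (rule smooth_compose[OF smooth_cos smooth_diff[OF smooth_ident smooth_const]])
    then have "smooth (\<lambda>y. bump (real n * (cos (y - b / 2) - cos (b / 2))))"
      by (intro smooth_compose[OF smooth_bump, of "\<lambda>y. real n * (cos (y - b / 2) - cos (b / 2))"]
          smooth_mult smooth_diff smooth_const)
    moreover have "cos (y + 2 * pi - b / 2) = cos (y - b / 2)" for y
      using cos_periodic[of "y - b / 2"] by (simp add: algebra_simps)
    ultimately show ?thesis
      by (simp add: test_torus_iff periodic_2pi_def \<psi>_def[abs_def])
  qed
  have "(\<lambda>n. \<Lambda> (\<psi> n)) \<longlonglongrightarrow> \<Lambda> (indicator (periodize {0<..<b}))"
  proof (rule bcf_limit[OF \<Lambda>(1), of _ 1])
    show "\<psi> n \<in> borel_measurable borel" for n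
      using \<psi>[of n] by (intro borel_measurable_continuous_onI smooth_continuous) (simp add: test_torus_iff)
    show "\<bar>\<psi> n x\<bar> \<le> 1" for n x by (simp add: \<psi>_def bump_nonneg bump_le_1)
    show "(\<lambda>n. \<psi> n x) \<longlonglongrightarrow> indicator (periodize {0<..<b}) x" for x
    proof -
      have "x \<in> periodize {0<..<b} \<longleftrightarrow> cos (x - b / 2) - cos (b / 2) > 0"
        unfolding cos_arc[OF b] by (rule periodize_iff) (use b in auto)
      then have "indicator (periodize {0<..<b}) x = indicat_real {0<..} (cos (x - b / 2) - cos (b / 2))"
        by (simp add: indicator_def)
      then show ?thesis using bump_tendsto_indicator by (simp add: \<psi>_def)
    qed
  qed
  then have "(\<lambda>n. 0) \<longlonglongrightarrow> \<Lambda> (indicator (periodize {0<..<b}))" using \<Lambda>(2)[OF \<psi>] by simp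
  then show ?thesis by (simp add: LIMSEQ_const_iff)
qed

lemma sets_borel_periodize:
  assumes "A \<in> sets borel"
  shows "periodize A \<in> sets borel"
proof -
  have "(+) c ` A \<in> sets borel" for c :: real
  proof -
    have "(+) c ` A = (\<lambda>x. x - c) -` A \<inter> space borel" by force
    also have "\<dots> \<in> sets borel" using assms by (intro measurable_sets) auto
    finally show ?thesis .
  qed
  then show ?thesis unfolding periodize_eq_UN by auto
qed

text \<open>Dynkin's argument on the intersection-stable family of half-lines {..<b}: intersected
  with (0, 2 pi), each is empty or an arc starting at 0, so \<open>bcf_arc_eq_0\<close> applies.
  Only unions of disjoint sets have to be treated, which is what additivity of the functional can
  handle.\<close>

lemma bcf_periodic_eq_0:
  assumes \<Lambda>: "bounded_convergence_functional \<Lambda>" "\<And>\<psi>. \<psi> \<in> test_torus \<Longrightarrow> \<Lambda> \<psi> = 0"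
    and A: "A \<in> sets borel" "A \<subseteq> {0<..<2 * pi}"
  shows "\<Lambda> (indicator (periodize A)) = 0"
proof -
  define P where "P M = periodize (M \<inter> {0<..<2*pi})" for M
  have meas: "indicator (P M) \<in> borel_measurable borel" if "M \<in> sets borel" for M
    using that unfolding P_def by (intro borel_measurable_indicator sets_borel_periodize) auto
  have iff: "y \<in> P M \<longleftrightarrow> y rmod (2 * pi) \<in> M \<inter> {0<..<2*pi}" for y M
    unfolding P_def by (intro periodize_iff) auto
  \<comment> \<open>Complements are formed inside the whole open arc (0, 2 pi), so the value on that
    arc must be known first.\<close>
  have full: "\<Lambda> (indicator (P UNIV)) = 0"
    using bcf_arc_eq_0[OF \<Lambda>, of "2 * pi"] by (simp add: P_def)
  have borel: "sets borel = sigma_sets UNIV (range (lessThan :: real \<Rightarrow> _))"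
    unfolding borel_Iio by (simp add: sets_measure_of)
  have subset: "range (lessThan :: real \<Rightarrow> _) \<subseteq> Pow UNIV" by simp
  have Int_stable: "Int_stable (range (lessThan :: real \<Rightarrow> _))"
  proof (rule Int_stableI, elim imageE)
    fix M N and a b :: real assume "M = {..<a}" "N = {..<b}"
    then have "M \<inter> N = {..<min a b}" by auto
    then show "M \<inter> N \<in> range lessThan" by simp
  qed
  have "\<Lambda> (indicator (P M)) = 0" if "M \<in> sigma_sets UNIV (range (lessThan :: real \<Rightarrow> _))" for M
    using Int_stable subset that
  proof (induction rule: sigma_sets_induct_disjoint)
    case (basic M)
    then obtain b where b: "M = {..<b}" by auto
    have "M \<inter> {0<..<2*pi} = {0<..<max 0 (min b (2*pi))}" by (auto simp: b)
    then show ?case using bcf_arc_eq_0[OF \<Lambda>, of "max 0 (min b (2*pi))"] by (simp add: P_def)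
  next
    case empty
    have "indicator (P {}) = (\<lambda>x. 0::real)" by (simp add: iff fun_eq_iff indicator_def)
    then show ?case using bcf_zero[OF \<Lambda>(1)] by simp
  next
    case (compl M)
    have "indicator (P (UNIV - M)) = (\<lambda>x. indicator (P UNIV) x - indicat_real (P M) x)"
      by (auto simp: iff fun_eq_iff indicator_def)
    moreover have "\<Lambda> (\<lambda>x. indicator (P UNIV) x - indicat_real (P M) x) = \<Lambda> (indicator (P UNIV)) - \<Lambda> (indicator (P M))"
      using compl(1) unfolding borel[symmetric]
      by (intro bcf_diff[OF \<Lambda>(1)] meas bounded_range_indicator) auto
    ultimately show ?case using full compl by simp
  next
    case (union M)
    have Mb: "M i \<in> sets borel" for i using union(2) borel by auto
    \<comment> \<open>Finite additivity settles the partial unions; the countable union is then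
      their bounded pointwise limit.\<close>
    have fin: "\<Lambda> (indicator (P (\<Union>i<n. M i))) = 0" for n
    proof (induction n)
      case 0
      have "indicator (P {}) = (\<lambda>x. 0::real)" by (simp add: iff fun_eq_iff indicator_def)
      then show ?case using bcf_zero[OF \<Lambda>(1)] by simp
    next
      case (Suc n)
      have "M n \<inter> (\<Union>i<n. M i) = {}"
        using disjoint_family_onD[OF union(1), of n] by (simp add: Int_UN_distrib)
      then have "indicator (P (\<Union>i<Suc n. M i)) =
          (\<lambda>x. indicator (P (\<Union>i<n. M i)) x + indicat_real (P (M n)) x)"
        by (auto simp: iff fun_eq_iff indicator_def lessThan_Suc)
      moreover have "\<Lambda> (\<lambda>x. indicator (P (\<Union>i<n. M i)) x + indicat_real (P (M n)) x) =
          \<Lambda> (indicator (P (\<Union>i<n. M i))) + \<Lambda> (indicator (P (M n)))"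
        using Mb by (intro bcf_add[OF \<Lambda>(1)] meas bounded_range_indicator) auto
      ultimately show ?case using Suc union(3)[of n] by simp
    qed
    have "(\<lambda>n. \<Lambda> (indicator (P (\<Union>i<n. M i)))) \<longlonglongrightarrow> \<Lambda> (indicator (P (\<Union>i. M i)))"
    proof (rule bcf_limit[OF \<Lambda>(1), of _ 1])
      show "indicator (P (\<Union>i<n. M i)) \<in> borel_measurable borel" for n
        using Mb by (intro meas) auto
      show "\<bar>indicat_real (P (\<Union>i<n. M i)) x\<bar> \<le> 1" for n x by (simp add: indicator_def)
      show "(\<lambda>n. indicator (P (\<Union>i<n. M i)) x) \<longlonglongrightarrow> indicat_real (P (\<Union>i. M i)) x" for x
      proof -
        have "(\<lambda>n. indicat_real (\<Union>i<n. P (M i)) x) \<longlonglongrightarrow> indicator (\<Union>i. P (M i)) x"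
          by (rule LIMSEQ_indicator_UN)
        moreover have "P (\<Union>i\<in>I. M i) = (\<Union>i\<in>I. P (M i))" for I
          by (auto simp: iff)
        ultimately show ?thesis by simp
      qed
    qed
    then show ?case using fin by (simp add: LIMSEQ_const_iff)
  qed
  from this[of A] show ?thesis using A borel by (simp add: P_def Int_absorb2)
qed

text \<open>A Borel subset can be pulled back by translations and shears without losing
  measurability. The endpoints are removed because 0 and 2 pi are the same point of the torus and
  \<open>bcf_periodic_eq_0\<close> works on the open interval; only a null set is lost.\<close>

lemma borel_core:
  assumes "A \<in> sets lebesgue"
  obtains A\<^sub>0 where "A\<^sub>0 \<in> sets borel" "A\<^sub>0 \<subseteq> A \<inter> {0<..<2 * pi}"
    "A \<inter> {0..2 * pi} - A\<^sub>0 \<in> null_sets lebesgue"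
proof -
  have "A \<inter> {0<..<2*pi} \<in> sets lebesgue" using assms by auto
  then obtain S N N' where N: "A \<inter> {0<..<2*pi} = S \<union> N" "N \<subseteq> N'" "N' \<in> null_sets lborel" "S \<in> sets lborel"
    by (rule sets_completionE)
  have "A \<inter> {0..2*pi} - S \<subseteq> N' \<union> {0, 2 * pi}"
  proof
    fix x assume x: "x \<in> A \<inter> {0..2*pi} - S"
    show "x \<in> N' \<union> {0, 2 * pi}"
    proof (cases "x = 0 \<or> x = 2 * pi")
      case False
      then have "x \<in> A \<inter> {0<..<2*pi}" using x by auto
      then show ?thesis using N x by auto
    qed auto
  qed
  moreover have "N' \<union> {0, 2 * pi} \<in> null_sets lborel" using N(3) by (intro null_sets.Un) (auto intro: finite_imp_null_set_lborel)
  ultimately have "A \<inter> {0..2*pi} - S \<in> null_sets lebesgue"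
    by (rule null_sets_completion_subset[OF _ null_sets_completionI])
  then show ?thesis using N by (intro that[of S]) auto
qed

section \<open>Test functions separate integrable functions on the torus\<close>

lemma sigma_finite_lebesgue: "sigma_finite_measure (lebesgue :: 'a::euclidean_space measure)"
proof
  obtain A :: "'a set set" where A: "countable A" "A \<subseteq> sets lborel" "\<Union>A = space lborel" "\<forall>a\<in>A. emeasure lborel a \<noteq> \<infinity>"
    using lborel.sigma_finite_countable by blast
  show "\<exists>A :: 'a set set. countable A \<and> A \<subseteq> sets lebesgue \<and> \<Union>A = space lebesgue \<and> (\<forall>a\<in>A. emeasure lebesgue a \<noteq> \<infinity>)"
    using A by (intro exI[of _ A]) (auto simp: emeasure_completion main_part)
qed

text \<open>The fundamental lemma of the calculus of variations on the torus. Vanishing against test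
  functions passes to Borel subsets of the open interval by \<open>bcf_periodic_eq_0\<close>, hence
  to integrals over all measurable sets, and an integrable function with all these integrals zero
  vanishes almost everywhere.\<close>

lemma test_torus_separates:
  assumes h: "set_integrable lebesgue {0..2*pi} h"
    and zero: "\<And>\<psi>. \<psi> \<in> test_torus \<Longrightarrow> (LINT x:{0..2*pi}|lebesgue. \<psi> x *\<^sub>R h x) = (0::complex)"
  shows "AE x in lebesgue. x \<in> {0..2*pi} \<longrightarrow> h x = 0"
proof -
  define H where "H x = indicat_real {0..2*pi} x *\<^sub>R h x" for x
  have H: "integrable lebesgue H" using h by (simp add: set_integrable_def H_def[abs_def])
  define \<Lambda> where "\<Lambda> g = (LINT x|lebesgue. g x *\<^sub>R H x)" for g :: "real \<Rightarrow> real"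
  have \<Lambda>: "bounded_convergence_functional \<Lambda>"
    using bcf_integral[OF H, of "\<lambda>x. x"] measurable_completion[OF measurable_ident_sets[of lborel borel]]
    by (simp add: \<Lambda>_def[abs_def])
  have \<Lambda>0: "\<Lambda> \<psi> = 0" if "\<psi> \<in> test_torus" for \<psi>
    using zero[OF that] by (simp add: \<Lambda>_def H_def set_lebesgue_integral_def mult.commute)
  have "AE x in lebesgue. H x = 0"
  proof (rule sigma_finite_measure.density_zero[OF sigma_finite_lebesgue H])
    fix A assume A: "A \<in> sets (lebesgue :: real measure)"
    obtain A0 where A0: "A0 \<in> sets borel" "A0 \<subseteq> A \<inter> {0<..<2 * pi}"
      "A \<inter> {0..2 * pi} - A0 \<in> null_sets lebesgue"
      using borel_core[OF A] .
    have "AE x in lebesgue. x \<notin> A \<inter> {0..2 * pi} - A0" "AE x in lebesgue. x \<notin> {0, 2 * pi}"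
      by (rule AE_not_in[OF A0(3)])
        (rule AE_not_in[OF null_sets_completionI[OF finite_imp_null_set_lborel]], simp)
    then have "AE x in lebesgue. indicator A x *\<^sub>R H x = indicator (periodize A0) x *\<^sub>R H x"
    proof eventually_elim
      case (elim x)
      show ?case
      proof (cases "x \<in> {0<..<2*pi}")
        case True
        then have "x \<in> periodize A0 \<longleftrightarrow> x \<in> A0"
          using A0(2) by (subst periodize_iff) auto
        then show ?thesis using elim A0(2) True by (auto simp: indicator_def)
      next
        case False
        then show ?thesis using elim by (auto simp: H_def indicator_def)
      qed
    qed
    moreover have "(\<lambda>x. indicat_real S x *\<^sub>R H x) \<in> borel_measurable lebesgue" if "S \<in> sets lebesgue" for S
      using that H by measurable
    moreover have "periodize A0 \<in> sets lebesgue"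
      using sets_borel_periodize[OF A0(1)] by simp
    ultimately have "(LINT x:A|lebesgue. H x) = \<Lambda> (indicator (periodize A0))"
      unfolding \<Lambda>_def set_lebesgue_integral_def using A by (intro integral_cong_AE)
    also have "\<dots> = 0" using A0 by (intro bcf_periodic_eq_0[OF \<Lambda> \<Lambda>0]) auto
    finally show "(LINT x:A|lebesgue. H x) = 0" .
  qed
  then show ?thesis by eventually_elim (auto simp: H_def)
qed

section \<open>Continuity in the mean\<close>

lemma set_integrable_scaleR_continuous:
  fixes w :: "real \<Rightarrow> 'b::{second_countable_topology, banach}"
  assumes g: "continuous_on UNIV g" and w: "set_integrable lebesgue {a..b} w"
  shows "set_integrable lebesgue {a..b} (\<lambda>x. g x *\<^sub>R w x)"
proof -
  have "bounded (g ` {a..b})"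
    using compact_continuous_image[OF continuous_on_subset[OF g]] compact_imp_bounded by blast
  then obtain C where C: "\<And>x. x \<in> {a..b} \<Longrightarrow> \<bar>g x\<bar> \<le> C" unfolding bounded_iff real_norm_def by blast
  have int: "integrable lebesgue (\<lambda>x. indicat_real {a..b} x *\<^sub>R w x)" using w by (simp add: set_integrable_def)
  have "integrable lebesgue (\<lambda>x. g x *\<^sub>R (indicat_real {a..b} x *\<^sub>R w x))"
  proof (rule Bochner_Integration.integrable_bound)
    show "integrable lebesgue (\<lambda>x. C *\<^sub>R (indicat_real {a..b} x *\<^sub>R w x))"
      by (rule integrable_scaleR_right[OF int])
    have "g \<in> borel_measurable lebesgue"
      using borel_measurable_continuous_onI[OF g] by (simp add: measurable_completion)
    then show "(\<lambda>x. g x *\<^sub>R (indicat_real {a..b} x *\<^sub>R w x)) \<in> borel_measurable lebesgue"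
      using int by measurable
    show "AE x in lebesgue. norm (g x *\<^sub>R (indicat_real {a..b} x *\<^sub>R w x)) \<le> norm (C *\<^sub>R (indicat_real {a..b} x *\<^sub>R w x))"
    proof (rule AE_I2)
      fix x
      show "norm (g x *\<^sub>R (indicat_real {a..b} x *\<^sub>R w x)) \<le> norm (C *\<^sub>R (indicat_real {a..b} x *\<^sub>R w x))"
        using C[of x] by (cases "x \<in> {a..b}") (auto intro!: mult_right_mono)
    qed
  qed
  then show ?thesis by (simp add: set_integrable_def mult.commute)
qed

lemma L2_torus_measurable: "g \<in> L2_torus \<Longrightarrow> g \<in> borel_measurable lebesgue"
  and L2_torus_square_integrable: "g \<in> L2_torus \<Longrightarrow> set_integrable lebesgue {0..2*pi} (\<lambda>x. (norm (g x))\<^sup>2)"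
  by (simp_all add: L2_torus_def)

lemma L2_torus_square_measurable:
  assumes "g \<in> L2_torus"
  shows "(\<lambda>x. (norm (g x))\<^sup>2) \<in> borel_measurable lebesgue"
  using L2_torus_measurable[OF assms] by measurable

lemma set_integrable_const_Icc: "set_integrable lebesgue {a..b::real} (\<lambda>x. c :: real)"
  by (rule absolutely_integrable_on_const) simp

lemma borel_measurable_indicator_Icc:
  fixes f :: "real \<Rightarrow> 'b::{second_countable_topology, real_normed_vector}"
  shows "f \<in> borel_measurable lebesgue \<Longrightarrow> (\<lambda>x. indicat_real {a..b} x *\<^sub>R f x) \<in> borel_measurable lebesgue"
  by (intro borel_measurable_scaleR borel_measurable_indicator) auto

lemma L2_torus_integrable:
  assumes "g \<in> L2_torus"
  shows "set_integrable lebesgue {0..2*pi} g"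
  unfolding set_integrable_def
proof (rule Bochner_Integration.integrable_bound)
  have "set_integrable lebesgue {0..2*pi} (\<lambda>x. 1 + (norm (g x))\<^sup>2)"
    by (intro set_integral_add set_integrable_const_Icc L2_torus_square_integrable[OF assms])
  then show "integrable lebesgue (\<lambda>x. indicat_real {0..2*pi} x *\<^sub>R (1 + (norm (g x))\<^sup>2))"
    by (simp add: set_integrable_def)
  show "(\<lambda>x. indicat_real {0..2*pi} x *\<^sub>R g x) \<in> borel_measurable lebesgue"
    by (rule borel_measurable_indicator_Icc[OF L2_torus_measurable[OF assms]])
  have "y \<le> 1 + y\<^sup>2" for y :: real
    using sum_squares_ge_zero[of "y - 1/2" "0"] by (simp add: power2_eq_square algebra_simps)
  then show "AE x in lebesgue. norm (indicat_real {0..2*pi} x *\<^sub>R g x) \<le> norm (indicat_real {0..2*pi} x *\<^sub>R (1 + (norm (g x))\<^sup>2))"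
    by (intro AE_I2) (simp add: indicator_def)
qed

lemma L2_torus_diff:
  assumes "g \<in> L2_torus" "h \<in> L2_torus"
  shows "(\<lambda>x. g x - h x) \<in> L2_torus"
proof -
  have "set_integrable lebesgue {0..2*pi} (\<lambda>x. (norm (g x - h x))\<^sup>2)"
    unfolding set_integrable_def
  proof (rule Bochner_Integration.integrable_bound)
    have "set_integrable lebesgue {0..2*pi} (\<lambda>x. 2 * (norm (g x))\<^sup>2 + 2 * (norm (h x))\<^sup>2)"
      using assms by (intro set_integral_add set_integrable_mult_right L2_torus_square_integrable)
    then show "integrable lebesgue (\<lambda>x. indicat_real {0..2*pi} x *\<^sub>R (2 * (norm (g x))\<^sup>2 + 2 * (norm (h x))\<^sup>2))"
      by (simp add: set_integrable_def)
    show "(\<lambda>x. indicat_real {0..2*pi} x *\<^sub>R (norm (g x - h x))\<^sup>2) \<in> borel_measurable lebesgue"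
      using assms[THEN L2_torus_measurable] by (intro borel_measurable_indicator_Icc) measurable
    have "(norm (y - z))\<^sup>2 \<le> 2 * (norm y)\<^sup>2 + 2 * (norm z)\<^sup>2" for y z :: complex
    proof -
      have "(norm (y - z))\<^sup>2 \<le> (norm y + norm z)\<^sup>2"
        by (intro power_mono norm_triangle_ineq4) simp
      also have "\<dots> \<le> 2 * (norm y)\<^sup>2 + 2 * (norm z)\<^sup>2"
        using zero_le_power2[of "norm y - norm z"] unfolding power2_sum power2_diff by linarith
      finally show ?thesis .
    qed
    then show "AE x in lebesgue. norm (indicat_real {0..2*pi} x *\<^sub>R (norm (g x - h x))\<^sup>2) \<le>
        norm (indicat_real {0..2*pi} x *\<^sub>R (2 * (norm (g x))\<^sup>2 + 2 * (norm (h x))\<^sup>2))"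
      by (intro AE_I2) (simp add: indicator_def)
  qed
  moreover have "(\<lambda>x. g x - h x) \<in> borel_measurable lebesgue"
    using assms[THEN L2_torus_measurable] by measurable
  ultimately show ?thesis using assms by (simp add: L2_torus_def periodic_2pi_def)
qed

text \<open>Takes the place of the Cauchy-Schwarz inequality: |z| \<le> e/2 + |z|^2/(2e) is
  integrated over length 2 pi with e slightly above the norm. The first term gives pi e and the
  second at most e, whence the constant pi + 1.\<close>

lemma L1_le_L2:
  assumes "g \<in> L2_torus"
  shows "(LINT x:{0..2*pi}|lebesgue. norm (g x)) \<le> (pi + 1) * L2_norm g"
proof (rule field_le_epsilon)
  fix d :: real assume d: "d > 0"
  define N where "N = L2_norm g"
  \<comment> \<open>The shift keeps e positive even when the norm is 0, and multiplied by pi + 1 it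
    contributes exactly d to the final bound.\<close>
  define e where "e = N + d / (pi + 1)"
  have N: "N \<ge> 0" "(LINT x:{0..2*pi}|lebesgue. (norm (g x))\<^sup>2) = N\<^sup>2"
    by (auto simp: N_def L2_norm_def set_lebesgue_integral_def)
  have e: "e > 0" "N \<le> e" using N d by (auto simp: e_def add_nonneg_pos pi_gt_zero)
  have int: "set_integrable lebesgue {0..2*pi} (\<lambda>x. e / 2 + (norm (g x))\<^sup>2 / (2 * e))"
    using L2_torus_square_integrable[OF assms]
    by (intro set_integral_add set_integrable_const_Icc set_integrable_divide) auto
  have "norm z \<le> e / 2 + (norm z)\<^sup>2 / (2 * e)" for z :: complex
  proof -
    have "e * (2 * norm z) \<le> e * e + (norm z)\<^sup>2"
      using zero_le_power2[of "norm z - e"] unfolding power2_diff by (simp add: power2_eq_square algebra_simps)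
    then show ?thesis using e by (simp add: field_simps)
  qed
  then have "(LINT x:{0..2*pi}|lebesgue. norm (g x)) \<le> (LINT x:{0..2*pi}|lebesgue. e / 2 + (norm (g x))\<^sup>2 / (2 * e))"
    by (intro set_integral_mono set_integrable_norm L2_torus_integrable[OF assms] int)
  also have "\<dots> = (LINT x:{0..2*pi}|lebesgue. e / 2) + (LINT x:{0..2*pi}|lebesgue. (norm (g x))\<^sup>2 / (2 * e))"
    using L2_torus_square_integrable[OF assms]
    by (intro set_integral_add set_integrable_const_Icc set_integrable_divide) auto
  also have "\<dots> = pi * e + N\<^sup>2 / (2 * e)"
    using N by (simp add: set_lebesgue_integral_def)
  also have "\<dots> \<le> pi * e + e"
  proof -
    have "N\<^sup>2 \<le> e * e" using N e by (simp add: power2_eq_square mult_mono)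
    also have "\<dots> \<le> e * (2 * e)" using e by simp
    finally show ?thesis using e by (simp add: field_simps power2_eq_square)
  qed
  also have "\<dots> = (pi + 1) * N + d"
  proof -
    have "pi + 1 \<noteq> 0" using pi_gt_zero by linarith
    then have "(pi + 1) * e = (pi + 1) * N + d" by (simp add: e_def distrib_left)
    then show ?thesis by (simp add: distrib_right)
  qed
  finally show "(LINT x:{0..2*pi}|lebesgue. norm (g x)) \<le> (pi + 1) * L2_norm g + d" by (simp add: N_def)
qed

section \<open>Weak derivatives of periodic functions\<close>

lemma weak_deriv_L2: "g \<in> H1_torus \<Longrightarrow> weak_deriv g \<in> L2_torus"
  and weak_deriv_has_weak_deriv: "g \<in> H1_torus \<Longrightarrow> has_weak_deriv g (weak_deriv g)"
proof -
  assume "g \<in> H1_torus"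
  then have "\<exists>h. h \<in> L2_torus \<and> has_weak_deriv g h" by (auto simp: H1_torus_def)
  then have "weak_deriv g \<in> L2_torus \<and> has_weak_deriv g (weak_deriv g)"
    unfolding weak_deriv_def by (rule someI_ex)
  then show "weak_deriv g \<in> L2_torus" "has_weak_deriv g (weak_deriv g)" by auto
qed

lemma test_torus_continuous: "\<psi> \<in> test_torus \<Longrightarrow> continuous_on S \<psi>"
  by (simp add: test_torus_iff smooth_continuous)

lemma test_torus_deriv_continuous: "\<psi> \<in> test_torus \<Longrightarrow> continuous_on S (deriv \<psi>)"
  by (simp add: test_torus_iff smooth_continuous smooth_deriv)

lemma has_weak_deriv_diff:
  assumes "g\<^sub>1 \<in> L2_torus" "g\<^sub>2 \<in> L2_torus" "h\<^sub>1 \<in> L2_torus" "h\<^sub>2 \<in> L2_torus"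
    "has_weak_deriv g\<^sub>1 h\<^sub>1" "has_weak_deriv g\<^sub>2 h\<^sub>2"
  shows "has_weak_deriv (\<lambda>x. g\<^sub>1 x - g\<^sub>2 x) (\<lambda>x. h\<^sub>1 x - h\<^sub>2 x)"
  unfolding has_weak_deriv_def
proof
  fix \<psi> :: "real \<Rightarrow> real" assume \<psi>: "\<psi> \<in> test_torus"
  have split: "(LINT x:{0..2*pi}|lebesgue. q x *\<^sub>R (a x - b x)) =
      (LINT x:{0..2*pi}|lebesgue. q x *\<^sub>R a x) - (LINT x:{0..2*pi}|lebesgue. q x *\<^sub>R b x)"
    if "continuous_on UNIV q" "a \<in> L2_torus" "b \<in> L2_torus" for q a b
    unfolding scaleR_diff_right using that
    by (intro set_integral_diff set_integrable_scaleR_continuous L2_torus_integrable)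
  show "(LINT x:{0..2*pi}|lebesgue. deriv \<psi> x *\<^sub>R (g\<^sub>1 x - g\<^sub>2 x)) = - (LINT x:{0..2*pi}|lebesgue. \<psi> x *\<^sub>R (h\<^sub>1 x - h\<^sub>2 x))"
    using assms(5,6) \<psi> assms(1-4) test_torus_continuous[OF \<psi>] test_torus_deriv_continuous[OF \<psi>]
    by (simp add: split has_weak_deriv_def)
qed

lemma has_weak_deriv_unique:
  assumes "h\<^sub>1 \<in> L2_torus" "h\<^sub>2 \<in> L2_torus" "has_weak_deriv g h\<^sub>1" "has_weak_deriv g h\<^sub>2"
  shows "AE x in lebesgue. x \<in> {0..2*pi} \<longrightarrow> h\<^sub>1 x = h\<^sub>2 x"
proof -
  have "AE x in lebesgue. x \<in> {0..2*pi} \<longrightarrow> h\<^sub>1 x - h\<^sub>2 x = 0"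
  proof (rule test_torus_separates)
    show "set_integrable lebesgue {0..2*pi} (\<lambda>x. h\<^sub>1 x - h\<^sub>2 x)"
      using assms by (intro set_integral_diff L2_torus_integrable)
    fix \<psi> :: "real \<Rightarrow> real" assume \<psi>: "\<psi> \<in> test_torus"
    have "(LINT x:{0..2*pi}|lebesgue. \<psi> x *\<^sub>R (h\<^sub>1 x - h\<^sub>2 x)) =
        (LINT x:{0..2*pi}|lebesgue. \<psi> x *\<^sub>R h\<^sub>1 x) - (LINT x:{0..2*pi}|lebesgue. \<psi> x *\<^sub>R h\<^sub>2 x)"
      unfolding scaleR_diff_right using assms(1,2) test_torus_continuous[OF \<psi>]
      by (intro set_integral_diff set_integrable_scaleR_continuous L2_torus_integrable)
    also have "\<dots> = 0"
    proof -
      have "- (LINT x:{0..2*pi}|lebesgue. \<psi> x *\<^sub>R h\<^sub>1 x) = - (LINT x:{0..2*pi}|lebesgue. \<psi> x *\<^sub>R h\<^sub>2 x)"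
        using assms(3,4)[unfolded has_weak_deriv_def, rule_format, OF \<psi>] by (rule trans[OF sym])
      then show ?thesis by (simp only: neg_equal_iff_equal diff_self)
    qed
    finally show "(LINT x:{0..2*pi}|lebesgue. \<psi> x *\<^sub>R (h\<^sub>1 x - h\<^sub>2 x)) = 0" .
  qed
  then show ?thesis by eventually_elim auto
qed

lemma H1_torus_L2: "g \<in> H1_torus \<Longrightarrow> g \<in> L2_torus"
  by (simp add: H1_torus_def)

text \<open>\<open>weak_deriv\<close> chooses a representative and need not be additive pointwise;
  uniqueness gives equality almost everywhere, which is enough for the norm. This turns convergence
  in \<open>H1_norm\<close> into convergence of the chosen derivatives.\<close>

lemma L2_norm_weak_deriv_diff:
  assumes "g \<in> H1_torus" "h \<in> H1_torus"
  shows "L2_norm (\<lambda>x. weak_deriv g x - weak_deriv h x) = L2_norm (weak_deriv (\<lambda>x. g x - h x))"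
proof -
  have L2: "(\<lambda>x. weak_deriv g x - weak_deriv h x) \<in> L2_torus"
    by (rule L2_torus_diff[OF assms[THEN weak_deriv_L2]])
  have wd: "has_weak_deriv (\<lambda>x. g x - h x) (\<lambda>x. weak_deriv g x - weak_deriv h x)"
    by (rule has_weak_deriv_diff[OF assms[THEN H1_torus_L2] assms[THEN weak_deriv_L2]
          assms[THEN weak_deriv_has_weak_deriv]])
  then have H1: "(\<lambda>x. g x - h x) \<in> H1_torus"
    using L2 L2_torus_diff[OF assms[THEN H1_torus_L2]] by (auto simp: H1_torus_def)
  have "AE x in lebesgue. x \<in> {0..2*pi} \<longrightarrow> weak_deriv g x - weak_deriv h x = weak_deriv (\<lambda>x. g x - h x) x"
    by (rule has_weak_deriv_unique[OF L2 weak_deriv_L2[OF H1] wd weak_deriv_has_weak_deriv[OF H1]])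
  then have "AE x in lebesgue. indicat_real {0..2*pi} x *\<^sub>R (norm (weak_deriv g x - weak_deriv h x))\<^sup>2 =
      indicat_real {0..2*pi} x *\<^sub>R (norm (weak_deriv (\<lambda>x. g x - h x) x))\<^sup>2"
    by eventually_elim (auto simp: indicator_def)
  then have "(LINT x:{0..2*pi}|lebesgue. (norm (weak_deriv g x - weak_deriv h x))\<^sup>2) =
      (LINT x:{0..2*pi}|lebesgue. (norm (weak_deriv (\<lambda>x. g x - h x) x))\<^sup>2)"
    unfolding set_lebesgue_integral_def
    by (intro integral_cong_AE borel_measurable_indicator_Icc
        L2_torus_square_measurable[OF L2] L2_torus_square_measurable[OF weak_deriv_L2[OF H1]])
  then show ?thesis by (simp add: L2_norm_def)
qed

text \<open>Continuity in time with values in L1 of the fundamental domain. It is enough for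
  pairings with continuous weights, and one notion covers \<open>u\<close>, its weak derivative in x
  and its time derivative.\<close>

definition C_L1 :: "real \<Rightarrow> (real \<Rightarrow> real \<Rightarrow> complex) \<Rightarrow> bool" where
  "C_L1 T w \<longleftrightarrow> (\<forall>t\<in>{0..T}. set_integrable lebesgue {0..2*pi} (w t)) \<and>
     (\<forall>t\<^sub>0\<in>{0..T}. ((\<lambda>t. LINT x:{0..2*pi}|lebesgue. norm (w t x - w t\<^sub>0 x)) \<longlongrightarrow> 0) (at t\<^sub>0 within {0..T}))"

lemma C_L1_integrable: "C_L1 T w \<Longrightarrow> t \<in> {0..T} \<Longrightarrow> set_integrable lebesgue {0..2*pi} (w t)"
  by (simp add: C_L1_def)

text \<open>The majorant \<open>N\<close> is left abstract so that the same argument serves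
  convergence in \<open>L2_norm\<close> and in \<open>H1_norm\<close>.\<close>

lemma C_L1_I_L2:
  assumes "\<And>t. t \<in> {0..T} \<Longrightarrow> w t \<in> L2_torus"
    and "\<And>t\<^sub>0. t\<^sub>0 \<in> {0..T} \<Longrightarrow> ((\<lambda>t. N t t\<^sub>0) \<longlongrightarrow> 0) (at t\<^sub>0 within {0..T})"
    and "\<And>t t\<^sub>0. t \<in> {0..T} \<Longrightarrow> t\<^sub>0 \<in> {0..T} \<Longrightarrow> L2_norm (\<lambda>x. w t x - w t\<^sub>0 x) \<le> N t t\<^sub>0"
  shows "C_L1 T w"
  unfolding C_L1_def
proof (intro conjI ballI)
  fix t\<^sub>0 assume t0: "t\<^sub>0 \<in> {0..T}"
  show "set_integrable lebesgue {0..2*pi} (w t\<^sub>0)" using assms(1) t0 by (intro L2_torus_integrable)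
  show "((\<lambda>t. LINT x:{0..2*pi}|lebesgue. norm (w t x - w t\<^sub>0 x)) \<longlongrightarrow> 0) (at t\<^sub>0 within {0..T})"
  proof (rule tendsto_sandwich)
    show "\<forall>\<^sub>F t in at t\<^sub>0 within {0..T}. 0 \<le> (LINT x:{0..2*pi}|lebesgue. norm (w t x - w t\<^sub>0 x))"
      by (simp add: set_lebesgue_integral_def)
    have "(LINT x:{0..2*pi}|lebesgue. norm (w t x - w t\<^sub>0 x)) \<le> (pi + 1) * N t t\<^sub>0" if t: "t \<in> {0..T}" for t
    proof -
      have "(LINT x:{0..2*pi}|lebesgue. norm (w t x - w t\<^sub>0 x)) \<le> (pi + 1) * L2_norm (\<lambda>x. w t x - w t\<^sub>0 x)"
        using assms(1) t t0 by (intro L1_le_L2 L2_torus_diff)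
      also have "\<dots> \<le> (pi + 1) * N t t\<^sub>0"
        using assms(3) t t0 by (intro mult_left_mono) auto
      finally show ?thesis .
    qed
    then show "\<forall>\<^sub>F t in at t\<^sub>0 within {0..T}. (LINT x:{0..2*pi}|lebesgue. norm (w t x - w t\<^sub>0 x)) \<le> (pi + 1) * N t t\<^sub>0"
      by (auto simp: eventually_at_filter)
    show "((\<lambda>t. (pi + 1) * N t t\<^sub>0) \<longlongrightarrow> 0) (at t\<^sub>0 within {0..T})"
      by (rule tendsto_mult_right_zero[OF assms(2)[OF t0]])
  qed simp
qed

lemma C_H1_L2_imp_C_L1:
  assumes "C_H1_L2 T u v"
  shows "C_L1 T u" "C_L1 T v" "C_L1 T (\<lambda>t. weak_deriv (u t))"
proof -
  have H1: "u t \<in> H1_torus" "v t \<in> L2_torus" if "t \<in> {0..T}" for t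
    using assms that by (auto simp: C_H1_L2_def)
  have lim: "((\<lambda>t. H1_norm (\<lambda>x. u t x - u t\<^sub>0 x)) \<longlongrightarrow> 0) (at t\<^sub>0 within {0..T})"
     "((\<lambda>t. L2_norm (\<lambda>x. v t x - v t\<^sub>0 x)) \<longlongrightarrow> 0) (at t\<^sub>0 within {0..T})" if "t\<^sub>0 \<in> {0..T}" for t\<^sub>0
    using assms that by (auto simp: C_H1_L2_def)
  have L2_le: "L2_norm g \<le> H1_norm g" "L2_norm (weak_deriv g) \<le> H1_norm g" for g
    by (auto simp: H1_norm_def intro!: real_le_rsqrt)
  show "C_L1 T v"
    by (rule C_L1_I_L2[OF H1(2) lim(2)]) auto
  show "C_L1 T u"
    by (rule C_L1_I_L2[OF H1_torus_L2[OF H1(1)] lim(1) L2_le(1)])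
  show "C_L1 T (\<lambda>t. weak_deriv (u t))"
    by (rule C_L1_I_L2[OF weak_deriv_L2[OF H1(1)] lim(1)])
      (use L2_norm_weak_deriv_diff[OF H1(1) H1(1)] L2_le(2) in auto)
qed

lemma C_L1_add_scaleR:
  assumes "C_L1 T v" "C_L1 T w"
  shows "C_L1 T (\<lambda>t x. v t x + c *\<^sub>R w t x)"
  unfolding C_L1_def
proof (intro conjI ballI)
  note int = C_L1_integrable[OF assms(1)] C_L1_integrable[OF assms(2)]
  fix t\<^sub>0 assume t0: "t\<^sub>0 \<in> {0..T}"
  show "set_integrable lebesgue {0..2*pi} (\<lambda>x. v t\<^sub>0 x + c *\<^sub>R w t\<^sub>0 x)"
    using int t0 by (intro set_integral_add set_integrable_scaleR_right) auto
  let ?D = "\<lambda>v t. LINT x:{0..2*pi}|lebesgue. norm (v t x - v t\<^sub>0 x :: complex)"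
  show "((\<lambda>t. LINT x:{0..2*pi}|lebesgue. norm (v t x + c *\<^sub>R w t x - (v t\<^sub>0 x + c *\<^sub>R w t\<^sub>0 x))) \<longlongrightarrow> 0) (at t\<^sub>0 within {0..T})"
  proof (rule tendsto_sandwich)
    show "\<forall>\<^sub>F t in at t\<^sub>0 within {0..T}. 0 \<le> (LINT x:{0..2*pi}|lebesgue. norm (v t x + c *\<^sub>R w t x - (v t\<^sub>0 x + c *\<^sub>R w t\<^sub>0 x)))"
      by (simp add: set_lebesgue_integral_def)
    have "(LINT x:{0..2*pi}|lebesgue. norm (v t x + c *\<^sub>R w t x - (v t\<^sub>0 x + c *\<^sub>R w t\<^sub>0 x))) \<le> ?D v t + \<bar>c\<bar> * ?D w t"
      if t: "t \<in> {0..T}" for t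
    proof -
      have i: "set_integrable lebesgue {0..2*pi} (\<lambda>x. norm (v t x - v t\<^sub>0 x))"
        "set_integrable lebesgue {0..2*pi} (\<lambda>x. \<bar>c\<bar> * norm (w t x - w t\<^sub>0 x))"
        using int t t0 by (auto intro!: set_integrable_mult_right set_integrable_norm set_integral_diff)
      have "norm (a + c *\<^sub>R b - (a' + c *\<^sub>R b')) \<le> norm (a - a') + \<bar>c\<bar> * norm (b - b')" for a a' b b' :: complex
      proof -
        have "a + c *\<^sub>R b - (a' + c *\<^sub>R b') = (a - a') + c *\<^sub>R (b - b')" by (simp add: scaleR_diff_right)
        moreover have "norm (c *\<^sub>R (b - b')) = \<bar>c\<bar> * norm (b - b')" by (rule norm_scaleR)
        ultimately show ?thesis using norm_triangle_ineq[of "a - a'" "c *\<^sub>R (b - b')"] by (simp only:)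
      qed
      then have "(LINT x:{0..2*pi}|lebesgue. norm (v t x + c *\<^sub>R w t x - (v t\<^sub>0 x + c *\<^sub>R w t\<^sub>0 x))) \<le>
          (LINT x:{0..2*pi}|lebesgue. norm (v t x - v t\<^sub>0 x) + \<bar>c\<bar> * norm (w t x - w t\<^sub>0 x))"
        using int t t0 i
        by (intro set_integral_mono set_integrable_norm set_integral_diff set_integral_add set_integrable_scaleR_right) auto
      also have "\<dots> = ?D v t + (LINT x:{0..2*pi}|lebesgue. \<bar>c\<bar> * norm (w t x - w t\<^sub>0 x))"
        by (rule set_integral_add[OF i])
      also have "\<dots> = ?D v t + \<bar>c\<bar> * ?D w t" by simp
      finally show ?thesis .
    qed
    then show "\<forall>\<^sub>F t in at t\<^sub>0 within {0..T}.
        (LINT x:{0..2*pi}|lebesgue. norm (v t x + c *\<^sub>R w t x - (v t\<^sub>0 x + c *\<^sub>R w t\<^sub>0 x))) \<le> ?D v t + \<bar>c\<bar> * ?D w t"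
      by (auto simp: eventually_at_filter)
    have "((\<lambda>t. ?D v t + \<bar>c\<bar> * ?D w t) \<longlongrightarrow> 0 + \<bar>c\<bar> * 0) (at t\<^sub>0 within {0..T})"
      using assms t0 by (intro tendsto_add tendsto_mult tendsto_const) (auto simp: C_L1_def)
    then show "((\<lambda>t. ?D v t + \<bar>c\<bar> * ?D w t) \<longlongrightarrow> 0) (at t\<^sub>0 within {0..T})" by simp
  qed simp
qed

lemma continuous_on_slice:
  "continuous_on UNIV g \<Longrightarrow> continuous_on UNIV (\<lambda>x. g (t, x))"
  using continuous_on_compose2[of UNIV g UNIV "\<lambda>x. (t, x)"] by (simp add: continuous_on_Pair)

text \<open>Along a sequence s n the integrand is split into g(s n, x) (w(s n, x) - w(t0, x)),
  controlled by continuity in the mean, and g(s n, x) w(t0, x) with a fixed slice of w, controlled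
  by dominated convergence.\<close>

lemma continuous_pairing:
  assumes w: "C_L1 T w" and g: "continuous_on UNIV g"
  shows "continuous_on {0..T} (\<lambda>t. LINT x:{0..2*pi}|lebesgue. g (t, x) *\<^sub>R w t x)"
  unfolding continuous_on_sequentially
proof (intro allI ballI impI, elim conjE)
  fix s :: "nat \<Rightarrow> real" and t\<^sub>0
  assume t0: "t\<^sub>0 \<in> {0..T}" and s: "\<forall>n. s n \<in> {0..T}" "s \<longlonglongrightarrow> t\<^sub>0"
  let ?S = "{0..2*pi}"
  note cont = continuous_on_slice[OF g]
  have "bounded (g ` ({0..T} \<times> ?S))"
    by (intro compact_imp_bounded compact_continuous_image continuous_on_subset[OF g] compact_Times compact_Icc subset_UNIV)
  then obtain C where C: "\<And>t x. t \<in> {0..T} \<Longrightarrow> x \<in> ?S \<Longrightarrow> \<bar>g (t, x)\<bar> \<le> C"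
    unfolding bounded_iff by fastforce
  define D where "D t = (LINT x:?S|lebesgue. norm (w t x - w t\<^sub>0 x))" for t
  have D0: "D t\<^sub>0 = 0" by (simp add: D_def set_lebesgue_integral_def)
  have "(D \<longlongrightarrow> 0) (at t\<^sub>0 within {0..T})"
    using w t0 unfolding C_L1_def D_def[abs_def] by blast
  \<comment> \<open>The punctured limit says nothing about indices with s n = t0. Since D vanishes
    at t0, it upgrades to continuity there, which covers them.\<close>
  then have "continuous (at t\<^sub>0 within {0..T}) D"
    by (simp add: continuous_within D0)
  then have "(\<lambda>n. D (s n)) \<longlonglongrightarrow> D t\<^sub>0"
    by (rule continuous_within_tendsto_compose') (use s in auto)
  then have D: "(\<lambda>n. C * D (s n)) \<longlonglongrightarrow> 0"
    by (intro tendsto_mult_right_zero) (simp add: D0)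
  have int: "set_integrable lebesgue ?S (w t)" if "t \<in> {0..T}" for t using C_L1_integrable[OF w that] .
  have "(\<lambda>n. LINT x:?S|lebesgue. g (s n, x) *\<^sub>R (w (s n) x - w t\<^sub>0 x)) \<longlonglongrightarrow> 0"
  proof (rule Lim_null_comparison[OF _ D], rule always_eventually, rule allI)
    fix n
    have i: "set_integrable lebesgue ?S (\<lambda>x. w (s n) x - w t\<^sub>0 x)"
      using int s t0 by (intro set_integral_diff) auto
    have "norm (LINT x:?S|lebesgue. g (s n, x) *\<^sub>R (w (s n) x - w t\<^sub>0 x)) \<le> (LINT x:?S|lebesgue. norm (g (s n, x) *\<^sub>R (w (s n) x - w t\<^sub>0 x)))"
      by (intro set_integral_norm_bound set_integrable_scaleR_continuous[OF cont] i)
    also have "\<dots> \<le> (LINT x:?S|lebesgue. C * norm (w (s n) x - w t\<^sub>0 x))"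
      using C s
      by (intro set_integral_mono set_integrable_norm set_integrable_scaleR_continuous[OF cont] set_integrable_mult_right i)
         (auto intro!: mult_right_mono)
    also have "\<dots> = C * D (s n)" by (simp add: D_def)
    finally show "norm (LINT x:?S|lebesgue. g (s n, x) *\<^sub>R (w (s n) x - w t\<^sub>0 x)) \<le> C * D (s n)" .
  qed
  moreover have "(\<lambda>n. LINT x:?S|lebesgue. g (s n, x) *\<^sub>R w t\<^sub>0 x) \<longlonglongrightarrow> (LINT x:?S|lebesgue. g (t\<^sub>0, x) *\<^sub>R w t\<^sub>0 x)"
    unfolding set_lebesgue_integral_def
  proof (rule integral_dominated_convergence[where w = "\<lambda>x. C * norm (indicat_real ?S x *\<^sub>R w t\<^sub>0 x)"])
    show "integrable lebesgue (\<lambda>x. C * norm (indicat_real ?S x *\<^sub>R w t\<^sub>0 x))"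
      using int[OF t0] unfolding set_integrable_def by (intro integrable_mult_right integrable_norm)
    show "(\<lambda>x. indicat_real ?S x *\<^sub>R g (t\<^sub>0, x) *\<^sub>R w t\<^sub>0 x) \<in> borel_measurable lebesgue"
      "(\<lambda>x. indicat_real ?S x *\<^sub>R g (s n, x) *\<^sub>R w t\<^sub>0 x) \<in> borel_measurable lebesgue" for n
      using set_integrable_scaleR_continuous[OF cont int[OF t0]]
      by (auto simp: set_integrable_def dest!: borel_measurable_integrable)
    show "AE x in lebesgue. (\<lambda>n. indicat_real ?S x *\<^sub>R g (s n, x) *\<^sub>R w t\<^sub>0 x) \<longlonglongrightarrow> indicat_real ?S x *\<^sub>R g (t\<^sub>0, x) *\<^sub>R w t\<^sub>0 x"
    proof (rule AE_I2)
      fix x :: real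
      have "(\<lambda>n. (s n, x)) \<longlonglongrightarrow> (t\<^sub>0, x)" using s by (intro tendsto_Pair) auto
      then have "(\<lambda>n. g (s n, x)) \<longlonglongrightarrow> g (t\<^sub>0, x)"
        by (rule continuous_on_tendsto_compose[OF g]) auto
      then show "(\<lambda>n. indicat_real ?S x *\<^sub>R g (s n, x) *\<^sub>R w t\<^sub>0 x) \<longlonglongrightarrow> indicat_real ?S x *\<^sub>R g (t\<^sub>0, x) *\<^sub>R w t\<^sub>0 x"
        by (intro tendsto_scaleR tendsto_const)
    qed
    show "AE x in lebesgue. norm (indicat_real ?S x *\<^sub>R g (s n, x) *\<^sub>R w t\<^sub>0 x) \<le> C * norm (indicat_real ?S x *\<^sub>R w t\<^sub>0 x)" for n
      using C s by (intro AE_I2) (auto simp: indicator_def intro!: mult_right_mono)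
  qed
  ultimately have "(\<lambda>n. (LINT x:?S|lebesgue. g (s n, x) *\<^sub>R (w (s n) x - w t\<^sub>0 x)) + (LINT x:?S|lebesgue. g (s n, x) *\<^sub>R w t\<^sub>0 x))
      \<longlonglongrightarrow> 0 + (LINT x:?S|lebesgue. g (t\<^sub>0, x) *\<^sub>R w t\<^sub>0 x)"
    by (rule tendsto_add)
  moreover have "(LINT x:?S|lebesgue. g (s n, x) *\<^sub>R (w (s n) x - w t\<^sub>0 x)) + (LINT x:?S|lebesgue. g (s n, x) *\<^sub>R w t\<^sub>0 x)
      = (LINT x:?S|lebesgue. g (s n, x) *\<^sub>R w (s n) x)" for n
  proof -
    have "set_integrable lebesgue ?S (\<lambda>x. g (s n, x) *\<^sub>R (w (s n) x - w t\<^sub>0 x))"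
      "set_integrable lebesgue ?S (\<lambda>x. g (s n, x) *\<^sub>R w t\<^sub>0 x)"
      using int s t0 by (auto intro!: set_integrable_scaleR_continuous[OF cont] set_integral_diff)
    from set_integral_add(2)[OF this] show ?thesis by (simp add: scaleR_diff_right)
  qed
  ultimately show "((\<lambda>t. LINT x:?S|lebesgue. g (t, x) *\<^sub>R w t x) \<circ> s) \<longlonglongrightarrow> (LINT x:?S|lebesgue. g (t\<^sub>0, x) *\<^sub>R w t\<^sub>0 x)"
    by (simp add: o_def)
qed

section \<open>The transport equation\<close>

text \<open>Integrability in t comes from continuity of the inner integral rather than from Fubini,
  as \<open>w\<close> need not be jointly measurable.\<close>

lemma pairing_set_integrable:
  assumes "C_L1 T w" "continuous_on UNIV g"
  shows "set_integrable lebesgue {0<..<T} (\<lambda>t. LINT x:{0..2*pi}|lebesgue. g (t, x) *\<^sub>R w t x)"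
proof (rule set_integrable_subset)
  show "set_integrable lebesgue {0..T} (\<lambda>t. LINT x:{0..2*pi}|lebesgue. g (t, x) *\<^sub>R w t x)"
    by (rule absolutely_integrable_continuous_real[OF continuous_pairing[OF assms]])
qed auto

lemma pair_cylinder_diff:
  assumes "C_L1 T w" "continuous_on UNIV g" "continuous_on UNIV h"
  shows "pair_cylinder T w (\<lambda>p. g p - c * h p) = pair_cylinder T w g - c *\<^sub>R pair_cylinder T w h"
proof -
  let ?P = "\<lambda>g t. LINT x:{0..2*pi}|lebesgue. g (t, x) *\<^sub>R w t x"
  have "(LINT x:{0..2*pi}|lebesgue. (g (t, x) - c * h (t, x)) *\<^sub>R w t x) = ?P g t - c *\<^sub>R ?P h t"
    if t: "t \<in> {0<..<T}" for t
  proof -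
    have int: "set_integrable lebesgue {0..2*pi} (\<lambda>x. g (t, x) *\<^sub>R w t x)"
      "set_integrable lebesgue {0..2*pi} (\<lambda>x. h (t, x) *\<^sub>R w t x)"
      using assms(2,3)[THEN continuous_on_slice] C_L1_integrable[OF assms(1), of t] t
      by (auto intro: set_integrable_scaleR_continuous)
    have "(LINT x:{0..2*pi}|lebesgue. (g (t, x) - c * h (t, x)) *\<^sub>R w t x) =
      (LINT x:{0..2*pi}|lebesgue. g (t, x) *\<^sub>R w t x - c *\<^sub>R (h (t, x) *\<^sub>R w t x))"
      by (simp add: scaleR_diff_left)
    also have "\<dots> = ?P g t - (LINT x:{0..2*pi}|lebesgue. c *\<^sub>R (h (t, x) *\<^sub>R w t x))"
      by (rule set_integral_diff(2)[OF int(1) set_integrable_scaleR_right]) (rule int(2))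
    also have "(LINT x:{0..2*pi}|lebesgue. c *\<^sub>R (h (t, x) *\<^sub>R w t x)) = c *\<^sub>R ?P h t"
      by (rule set_integral_scaleR_right)
    finally show ?thesis .
  qed
  then have "pair_cylinder T w (\<lambda>p. g p - c * h p) = (LINT t:{0<..<T}|lebesgue. ?P g t - c *\<^sub>R ?P h t)"
    unfolding pair_cylinder_def by (intro set_lebesgue_integral_cong) auto
  also have "\<dots> = (LINT t:{0<..<T}|lebesgue. ?P g t) - (LINT t:{0<..<T}|lebesgue. c *\<^sub>R ?P h t)"
    by (rule set_integral_diff(2)[OF pairing_set_integrable set_integrable_scaleR_right])
       (use assms pairing_set_integrable in auto)
  also have "(LINT t:{0<..<T}|lebesgue. c *\<^sub>R ?P h t) = c *\<^sub>R (LINT t:{0<..<T}|lebesgue. ?P h t)"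
    by (rule set_integral_scaleR_right)
  finally show ?thesis by (simp add: pair_cylinder_def)
qed

lemma pair_cylinder_add_scaleR:
  assumes "C_L1 T v" "C_L1 T w" "continuous_on UNIV g"
  shows "pair_cylinder T (\<lambda>t x. v t x + c *\<^sub>R w t x) g = pair_cylinder T v g + c *\<^sub>R pair_cylinder T w g"
proof -
  let ?P = "\<lambda>w t. LINT x:{0..2*pi}|lebesgue. g (t, x) *\<^sub>R (w t x :: complex)"
  have "(LINT x:{0..2*pi}|lebesgue. g (t, x) *\<^sub>R (v t x + c *\<^sub>R w t x)) = ?P v t + c *\<^sub>R ?P w t"
    if t: "t \<in> {0<..<T}" for t
  proof -
    have int: "set_integrable lebesgue {0..2*pi} (\<lambda>x. g (t, x) *\<^sub>R v t x)"
      "set_integrable lebesgue {0..2*pi} (\<lambda>x. g (t, x) *\<^sub>R w t x)"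
      using continuous_on_slice[OF assms(3)] C_L1_integrable[OF assms(1), of t] C_L1_integrable[OF assms(2), of t] t
      by (auto intro: set_integrable_scaleR_continuous)
    have "(LINT x:{0..2*pi}|lebesgue. g (t, x) *\<^sub>R (v t x + c *\<^sub>R w t x)) =
      (LINT x:{0..2*pi}|lebesgue. g (t, x) *\<^sub>R v t x + c *\<^sub>R (g (t, x) *\<^sub>R w t x))"
      by (simp add: scaleR_add_right mult.commute)
    also have "\<dots> = ?P v t + (LINT x:{0..2*pi}|lebesgue. c *\<^sub>R (g (t, x) *\<^sub>R w t x))"
      by (rule set_integral_add(2)[OF int(1) set_integrable_scaleR_right]) (rule int(2))
    also have "(LINT x:{0..2*pi}|lebesgue. c *\<^sub>R (g (t, x) *\<^sub>R w t x)) = c *\<^sub>R ?P w t"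
      by (rule set_integral_scaleR_right)
    finally show ?thesis .
  qed
  then have "pair_cylinder T (\<lambda>t x. v t x + c *\<^sub>R w t x) g = (LINT t:{0<..<T}|lebesgue. ?P v t + c *\<^sub>R ?P w t)"
    unfolding pair_cylinder_def by (intro set_lebesgue_integral_cong) auto
  also have "\<dots> = (LINT t:{0<..<T}|lebesgue. ?P v t) + (LINT t:{0<..<T}|lebesgue. c *\<^sub>R ?P w t)"
    by (rule set_integral_add(2)[OF pairing_set_integrable set_integrable_scaleR_right])
       (use assms pairing_set_integrable in auto)
  also have "(LINT t:{0<..<T}|lebesgue. c *\<^sub>R ?P w t) = c *\<^sub>R (LINT t:{0<..<T}|lebesgue. ?P w t)"
    by (rule set_integral_scaleR_right)
  finally show ?thesis by (simp add: pair_cylinder_def)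
qed

lemma pair_cylinder_dx:
  assumes "C_H1_L2 T u v" "\<phi> \<in> test_cylinder T"
  shows "pair_cylinder T u (dx \<phi>) = - pair_cylinder T (\<lambda>t. weak_deriv (u t)) \<phi>"
proof -
  have "(LINT x:{0..2*pi}|lebesgue. dx \<phi> (t, x) *\<^sub>R u t x) =
      - (LINT x:{0..2*pi}|lebesgue. \<phi> (t, x) *\<^sub>R weak_deriv (u t) x)" if "t \<in> {0<..<T}" for t
  proof -
    have "u t \<in> H1_torus" using assms(1) that by (auto simp: C_H1_L2_def)
    from weak_deriv_has_weak_deriv[OF this, unfolded has_weak_deriv_def, rule_format,
        OF test_cylinder_slice[OF assms(2), of t]]
    show ?thesis by (simp only: deriv_slice)
  qed
  then have "pair_cylinder T u (dx \<phi>) = (LINT t:{0<..<T}|lebesgue. - (LINT x:{0..2*pi}|lebesgue. \<phi> (t, x) *\<^sub>R weak_deriv (u t) x))"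
    unfolding pair_cylinder_def by (intro set_lebesgue_integral_cong) auto
  then show ?thesis by (simp add: pair_cylinder_def set_integral_uminus set_lebesgue_integral_def)
qed

text \<open>
  The wave operator factors as \<open>(\<partial>\<^sub>t - \<sigma> \<partial>\<^sub>x)(\<partial>\<^sub>t + \<sigma> \<partial>\<^sub>x)\<close>, so \<open>\<partial>\<^sub>x u + \<sigma> \<partial>\<^sub>t u\<close> solves a
  first-order transport equation.
\<close>

lemma weak_transport_equation:
  assumes C: "C_H1_L2 T u v" and v: "has_weak_time_deriv T u v" and F: "solves_wave_eq T u F"
    and \<sigma>: "\<sigma> * \<sigma> = 1"
    and \<phi>: "\<phi> \<in> test_cylinder T" "dt (dx \<phi>) = dx (dt \<phi>)"
  shows "pair_cylinder T (\<lambda>t x. weak_deriv (u t) x + \<sigma> *\<^sub>R v t x) (\<lambda>p. dx \<phi> p - \<sigma> * dt \<phi> p) =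
    (LINT p:{0<..<T} \<times> {0..2*pi}|lebesgue. \<phi> p *\<^sub>R F p)"
proof -
  note CL = C_H1_L2_imp_C_L1[OF C]
  let ?p = "\<lambda>t. weak_deriv (u t)"
  note d = test_cylinder_dt test_cylinder_dx
  note c = d[OF \<phi>(1), THEN test_cylinder_continuous]
  note c2 = d(1)[OF d(1)[OF \<phi>(1)], THEN test_cylinder_continuous]
    d(2)[OF d(2)[OF \<phi>(1)], THEN test_cylinder_continuous]
  have p: "pair_cylinder T ?p (dx \<phi>) = - pair_cylinder T u (dx (dx \<phi>))"
    "pair_cylinder T ?p (dt \<phi>) = - pair_cylinder T u (dx (dt \<phi>))"
    using pair_cylinder_dx[OF C] d[OF \<phi>(1)] by simp_all
  have q: "pair_cylinder T v (dx \<phi>) = - pair_cylinder T u (dt (dx \<phi>))"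
    "pair_cylinder T v (dt \<phi>) = - pair_cylinder T u (dt (dt \<phi>))"
    using v d[OF \<phi>(1)] by (simp_all add: has_weak_time_deriv_def)
  have w: "pair_cylinder T u (\<lambda>p. dt (dt \<phi>) p - 1 * dx (dx \<phi>) p) = (LINT p:{0<..<T} \<times> {0..2*pi}|lebesgue. \<phi> p *\<^sub>R F p)"
    using F \<phi>(1) by (simp add: solves_wave_eq_def)
  have "pair_cylinder T (\<lambda>t x. ?p t x + \<sigma> *\<^sub>R v t x) (\<lambda>p. dx \<phi> p - \<sigma> * dt \<phi> p) =
      (pair_cylinder T ?p (dx \<phi>) + \<sigma> *\<^sub>R pair_cylinder T v (dx \<phi>)) -
      \<sigma> *\<^sub>R (pair_cylinder T ?p (dt \<phi>) + \<sigma> *\<^sub>R pair_cylinder T v (dt \<phi>))"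
    by (simp only: pair_cylinder_diff[OF C_L1_add_scaleR[OF CL(3,2)] c(2) c(1)]
        pair_cylinder_add_scaleR[OF CL(3,2) c(1)] pair_cylinder_add_scaleR[OF CL(3,2) c(2)])
  \<comment> \<open>Of the four terms, the two mixed ones have opposite signs and cancel by
    \<open>\<phi>(2)\<close>; \<open>\<sigma> * \<sigma> = 1\<close> leaves the wave
    operator.\<close>
  also have "\<dots> = pair_cylinder T u (dt (dt \<phi>)) - 1 *\<^sub>R pair_cylinder T u (dx (dx \<phi>))"
    unfolding p q \<phi>(2) using \<sigma> by (simp add: algebra_simps)
  also have "\<dots> = (LINT p:{0<..<T} \<times> {0..2*pi}|lebesgue. \<phi> p *\<^sub>R F p)"
    by (subst pair_cylinder_diff[OF CL(1) c2, symmetric]) (rule w)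
  finally show ?thesis .
qed

text \<open>On a travelling wave, \<open>dx \<phi> p - \<sigma> * dt \<phi> p\<close> reduces to
  -\<sigma> \<theta>'(t) \<psi>(x + \<sigma> t), the terms with \<psi>' cancelling because
  \<open>\<sigma> * \<sigma> = 1\<close>. The result says that the pairing of w with \<psi>(x +
  \<sigma> t), as a function of t, has weak derivative \<sigma> times the pairing of F.\<close>

lemma weak_transport_travelling_wave:
  assumes C: "C_H1_L2 T u v" and v: "has_weak_time_deriv T u v" and F: "solves_wave_eq T u F"
    and \<sigma>: "\<sigma> * \<sigma> = 1"
    and \<theta>: "smooth \<theta>" "0 < a" "b < T" "\<And>t. \<theta> t \<noteq> 0 \<Longrightarrow> a \<le> t \<and> t \<le> b"
    and \<psi>: "\<psi> \<in> test_torus"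
  shows "(LINT t:{0<..<T}|lebesgue. deriv \<theta> t *\<^sub>R
      (LINT x:{0..2*pi}|lebesgue. \<psi> (x + \<sigma> * t) *\<^sub>R (weak_deriv (u t) x + \<sigma> *\<^sub>R v t x))) =
    - (\<sigma> *\<^sub>R (LINT p:{0<..<T} \<times> {0..2*pi}|lebesgue. travelling_wave \<sigma> \<theta> \<psi> p *\<^sub>R F p))"
proof -
  have \<psi>s: "smooth \<psi>" using \<psi> by (simp add: test_torus_iff)
  let ?w = "\<lambda>t x. weak_deriv (u t) x + \<sigma> *\<^sub>R v t x"
  let ?\<phi> = "travelling_wave \<sigma> \<theta> \<psi>"
  have "?\<phi> \<in> test_cylinder T" by (rule travelling_wave_in_test_cylinder[OF \<theta>(1) \<psi> \<theta>(2,3,4)])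
  from weak_transport_equation[OF C v F \<sigma> this travelling_wave_mixed_derivs[OF \<theta>(1) \<psi>s]]
  have "pair_cylinder T ?w (\<lambda>p. dx ?\<phi> p - \<sigma> * dt ?\<phi> p) = (LINT p:{0<..<T} \<times> {0..2*pi}|lebesgue. ?\<phi> p *\<^sub>R F p)" .
  also have "(\<lambda>p. dx ?\<phi> p - \<sigma> * dt ?\<phi> p) = (\<lambda>p. - \<sigma> * travelling_wave \<sigma> (deriv \<theta>) \<psi> p)"
    unfolding travelling_wave_derivs[OF \<theta>(1) \<psi>s]
    using \<sigma> by (simp add: travelling_wave_def fun_eq_iff algebra_simps)
  also have "pair_cylinder T ?w (\<lambda>p. - \<sigma> * travelling_wave \<sigma> (deriv \<theta>) \<psi> p) =
      (LINT t:{0<..<T}|lebesgue. (- \<sigma>) *\<^sub>R (deriv \<theta> t *\<^sub>R (LINT x:{0..2*pi}|lebesgue. \<psi> (x + \<sigma> * t) *\<^sub>R ?w t x)))"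
    unfolding pair_cylinder_def travelling_wave_def case_prod_conv
    by (simp only: scaleR_scaleR[symmetric] set_integral_scaleR_right)
  also have "\<dots> = (- \<sigma>) *\<^sub>R (LINT t:{0<..<T}|lebesgue. deriv \<theta> t *\<^sub>R (LINT x:{0..2*pi}|lebesgue. \<psi> (x + \<sigma> * t) *\<^sub>R ?w t x))"
    by (rule set_integral_scaleR_right)
  \<comment> \<open>A second factor -\<sigma> removes the first one, as their product is 1.\<close>
  finally have "(- \<sigma>) *\<^sub>R ((- \<sigma>) *\<^sub>R (LINT t:{0<..<T}|lebesgue. deriv \<theta> t *\<^sub>R (LINT x:{0..2*pi}|lebesgue. \<psi> (x + \<sigma> * t) *\<^sub>R ?w t x))) =
    (- \<sigma>) *\<^sub>R (LINT p:{0<..<T} \<times> {0..2*pi}|lebesgue. ?\<phi> p *\<^sub>R F p)"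
    by simp
  then show ?thesis using \<sigma> by simp
qed

section \<open>An approximate identity from the smooth step\<close>

lemma deriv_smooth_step_eq_0:
  assumes "y \<notin> {0..1}"
  shows "deriv smooth_step y = 0"
proof -
  have "\<exists>c. \<forall>\<^sub>F z in nhds y. smooth_step z = c"
  proof (cases "y < 0")
    case True
    then have "\<forall>\<^sub>F z in nhds y. z \<in> {..<0}" by (intro eventually_nhds_in_open) auto
    then have "\<forall>\<^sub>F z in nhds y. smooth_step z = 0" by eventually_elim (simp add: smooth_step_eq_0)
    then show ?thesis ..
  next
    case False
    then have "\<forall>\<^sub>F z in nhds y. z \<in> {1<..}" using assms by (intro eventually_nhds_in_open) auto
    then have "\<forall>\<^sub>F z in nhds y. smooth_step z = 1" by eventually_elim (simp add: smooth_step_eq_1)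
    then show ?thesis ..
  qed
  then obtain c where "\<forall>\<^sub>F z in nhds y. smooth_step z = c" ..
  then have "(smooth_step has_real_derivative 0) (at y)"
    by (subst DERIV_cong_ev[OF refl _ refl, where g = "\<lambda>_. c"]) auto
  then show ?thesis by (rule DERIV_imp_deriv)
qed

lemma integral_deriv_smooth_step: "(LINT y|lborel. indicat_real {0..1} y * deriv smooth_step y) = 1"
proof -
  have "(LINT y|lborel. deriv smooth_step y * indicat_real {0..1} y) = smooth_step 1 - smooth_step 0"
    by (rule integral_FTC_Icc_real)
       (auto intro: smooth_has_deriv[OF smooth_smooth_step]
         continuous_on_interior[OF smooth_continuous[OF smooth_deriv[OF smooth_smooth_step], of UNIV]])
  then show ?thesis by (simp add: smooth_step_eq_0 smooth_step_eq_1 mult.commute)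
qed

text \<open>The substitution r = s + (y + c)/n turns the kernel into the derivative of
  \<open>smooth_step\<close>, which vanishes off [0, 1] and has integral 1. The offset c moves the
  kernel to one side of s, so that no mass is lost outside (0, T) even when s is an
  endpoint.\<close>

lemma smooth_step_deriv_concentrates:
  fixes J :: "real \<Rightarrow> complex"
  assumes J: "continuous_on {0..T} J" and s: "s \<in> {0..T}"
    and c: "\<And>y. y \<in> {0..1} \<Longrightarrow> \<forall>\<^sub>F n in sequentially. s + (y + c) / real n \<in> {0<..<T}"
  shows "(\<lambda>n. LINT r:{0<..<T}|lebesgue. (real n * deriv smooth_step (real n * (r - s) - c)) *\<^sub>R J r) \<longlonglongrightarrow> J s"
proof -
  let ?D = "deriv smooth_step"
  have Dc: "continuous_on UNIV ?D" by (rule smooth_continuous[OF smooth_deriv[OF smooth_smooth_step]])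
  then have Dm: "?D \<in> borel_measurable borel" by (rule borel_measurable_continuous_onI)
  \<comment> \<open>Extension by zero gives a bounded Borel function on the whole line, where the
    affine change of variables and dominated convergence are carried out.\<close>
  define H where "H r = indicat_real {0<..<T} r *\<^sub>R J r" for r
  have Hm: "H \<in> borel_measurable borel"
    unfolding H_def by (rule borel_measurable_continuous_on_indicator) (auto intro: continuous_on_subset[OF J])
  have "bounded (J ` {0..T})" using compact_continuous_image[OF J compact_Icc] by (rule compact_imp_bounded)
  then obtain M where M: "\<And>r. r \<in> {0..T} \<Longrightarrow> norm (J r) \<le> M" unfolding bounded_iff by blast
  have HM: "norm (H r) \<le> \<bar>M\<bar>" for r using M[of r] by (cases "r \<in> {0<..<T}") (auto simp: H_def)
  have "set_integrable lborel {0..1} ?D"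
    by (rule borel_integrable_atLeastAtMost') (rule continuous_on_subset[OF Dc subset_UNIV])
  then have int: "integrable lborel (\<lambda>y. indicat_real {0..1} y * ?D y)" by (simp add: set_integrable_def)
  have eq: "(LINT r:{0<..<T}|lebesgue. (real n * ?D (real n * (r - s) - c)) *\<^sub>R J r) =
      (LINT y|lborel. ?D y *\<^sub>R H (s + (y + c) / real n))" if n: "n > 0" for n
  proof -
    define f where "f r = (real n * ?D (real n * (r - s) - c)) *\<^sub>R H r" for r
    have "f \<in> borel_measurable borel"
      unfolding f_def
      by (intro borel_measurable_scaleR borel_measurable_times Hm measurable_compose[OF _ Dm]) measurable
    then have "(LINT r|lebesgue. f r) = (LINT r|lborel. f r)"
      by (intro integral_completion) simp
    also have "\<dots> = \<bar>1 / real n\<bar> *\<^sub>R (LINT y|lborel. f ((s + c / real n) + 1 / real n * y))"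
      using n by (intro lborel_integral_real_affine) auto
    also have "(LINT y|lborel. f ((s + c / real n) + 1 / real n * y)) = (LINT y|lborel. real n *\<^sub>R (?D y *\<^sub>R H (s + (y + c) / real n)))"
    proof (rule Bochner_Integration.integral_cong[OF refl])
      fix y
      have e1: "(s + c / real n) + 1 / real n * y = s + (y + c) / real n" by (simp add: add_divide_distrib)
      have e2: "real n * (s + (y + c) / real n - s) - c = y" using n by simp
      show "f ((s + c / real n) + 1 / real n * y) = real n *\<^sub>R (?D y *\<^sub>R H (s + (y + c) / real n))"
        unfolding f_def e1 e2 by (rule scaleR_scaleR[symmetric])
    qed
    also have "\<dots> = real n *\<^sub>R (LINT y|lborel. ?D y *\<^sub>R H (s + (y + c) / real n))"
      by (rule integral_scaleR_right)
    finally have "(LINT r|lebesgue. f r) = (LINT y|lborel. ?D y *\<^sub>R H (s + (y + c) / real n))"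
      using n by (simp del: integral_scaleR_right)
    moreover have "(LINT r:{0<..<T}|lebesgue. (real n * ?D (real n * (r - s) - c)) *\<^sub>R J r) = (LINT r|lebesgue. f r)"
      unfolding set_lebesgue_integral_def f_def H_def by (simp add: ac_simps)
    ultimately show ?thesis by simp
  qed
  have "(\<lambda>n. LINT y|lborel. ?D y *\<^sub>R H (s + (y + c) / real n)) \<longlonglongrightarrow> (LINT y|lborel. (indicat_real {0..1} y * ?D y) *\<^sub>R J s)"
  proof (rule integral_dominated_convergence[where w = "\<lambda>y. \<bar>M\<bar> * \<bar>indicat_real {0..1} y * ?D y\<bar>"])
    show "integrable lborel (\<lambda>y. \<bar>M\<bar> * \<bar>indicat_real {0..1} y * ?D y\<bar>)"
      by (intro integrable_mult_right integrable_abs int)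
    show "(\<lambda>y. (indicat_real {0..1} y * ?D y) *\<^sub>R J s) \<in> borel_measurable lborel"
      using Dm by measurable
    show "(\<lambda>y. ?D y *\<^sub>R H (s + (y + c) / real n)) \<in> borel_measurable lborel" for n
      using Dm measurable_compose[OF _ Hm, of "\<lambda>y. s + (y + c) / real n" borel] by measurable
    show "AE y in lborel. norm (?D y *\<^sub>R H (s + (y + c) / real n)) \<le> \<bar>M\<bar> * \<bar>indicat_real {0..1} y * ?D y\<bar>" for n
    proof (rule AE_I2)
      fix y
      show "norm (?D y *\<^sub>R H (s + (y + c) / real n)) \<le> \<bar>M\<bar> * \<bar>indicat_real {0..1} y * ?D y\<bar>"
        using HM[of "s + (y + c) / real n"] deriv_smooth_step_eq_0[of y]
        by (cases "y \<in> {0..1}") (auto simp: mult.commute[of _ "\<bar>?D y\<bar>"] intro!: mult_left_mono)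
    qed
    show "AE y in lborel. (\<lambda>n. ?D y *\<^sub>R H (s + (y + c) / real n)) \<longlonglongrightarrow> (indicat_real {0..1} y * ?D y) *\<^sub>R J s"
    proof (rule AE_I2)
      fix y
      show "(\<lambda>n. ?D y *\<^sub>R H (s + (y + c) / real n)) \<longlonglongrightarrow> (indicat_real {0..1} y * ?D y) *\<^sub>R J s"
      proof (cases "y \<in> {0..1}")
        case True
        have "(\<lambda>n. s + (y + c) / real n) \<longlonglongrightarrow> s + 0"
          by (intro tendsto_add tendsto_const lim_const_over_n)
        then have "(\<lambda>n. J (s + (y + c) / real n)) \<longlonglongrightarrow> J s"
          using c[OF True] s by (intro continuous_on_tendsto_compose[OF J]) (auto elim: eventually_mono)
        moreover have "\<forall>\<^sub>F n in sequentially. J (s + (y + c) / real n) = H (s + (y + c) / real n)"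
          using c[OF True] by eventually_elim (simp add: H_def)
        ultimately have "(\<lambda>n. H (s + (y + c) / real n)) \<longlonglongrightarrow> J s" by (rule Lim_transform_eventually)
        then show ?thesis using True by (simp add: tendsto_scaleR)
      next
        case False
        then show ?thesis using deriv_smooth_step_eq_0[of y] by simp
      qed
    qed
  qed
  also have "(LINT y|lborel. (indicat_real {0..1} y * ?D y) *\<^sub>R J s) = J s"
    using integral_deriv_smooth_step int by (simp add: integral_scaleR_left)
  finally show ?thesis
    by (rule Lim_transform_eventually) (rule eventually_mono[OF eventually_gt_at_top[of 0] eq[symmetric]])
qed

section \<open>Integration along characteristics\<close>

lemma smooth_step_affine: "smooth (\<lambda>r. smooth_step (a * r + b))"
  by (rule smooth_compose[OF smooth_smooth_step smooth_add[OF smooth_mult[OF smooth_const smooth_ident] smooth_const]])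

lemma smooth_step_affine_deriv:
  "((\<lambda>r. smooth_step (a * r + b)) has_real_derivative a * deriv smooth_step (a * r + b)) (at r)"
proof -
  have "((\<lambda>r. smooth_step (a * r + b)) has_real_derivative deriv smooth_step (a * r + b) * a) (at r)"
    by (rule DERIV_chain2[OF smooth_has_deriv[OF smooth_smooth_step]]) (auto intro!: derivative_eq_intros)
  then show ?thesis by (simp only: mult.commute)
qed

lemma transport_integrated:
  assumes C: "C_H1_L2 T u v" and v: "has_weak_time_deriv T u v" and F: "solves_wave_eq T u F"
    and \<sigma>: "\<sigma> * \<sigma> = 1"
    and Fint: "set_integrable lebesgue ({0<..<T} \<times> {0..2*pi}) F"
    and \<psi>: "\<psi> \<in> test_torus" and t: "t \<in> {0..T}"
  shows "(LINT x:{0..2*pi}|lebesgue. \<psi> (x + \<sigma> * t) *\<^sub>R (weak_deriv (u t) x + \<sigma> *\<^sub>R v t x)) -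
      (LINT x:{0..2*pi}|lebesgue. \<psi> x *\<^sub>R (weak_deriv (u 0) x + \<sigma> *\<^sub>R v 0 x)) =
    \<sigma> *\<^sub>R (LINT p:{0<..<T} \<times> {0..2*pi}|lebesgue. (indicator {0<..<t} (fst p) * \<psi> (snd p + \<sigma> * fst p)) *\<^sub>R F p)"
proof (cases "t = 0")
  case True
  then show ?thesis by (simp add: set_lebesgue_integral_def)
next
  case False
  then have t: "0 < t" "t \<le> T" using t by auto
  let ?X = "{0<..<T} \<times> {0..2*pi}"
  define J where "J r = (LINT x:{0..2*pi}|lebesgue. \<psi> (x + \<sigma> * r) *\<^sub>R (weak_deriv (u r) x + \<sigma> *\<^sub>R v r x))" for r
  note CL = C_H1_L2_imp_C_L1[OF C]
  have J: "continuous_on {0..T} J"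
  proof -
    have "continuous_on UNIV (\<lambda>p::real \<times> real. \<psi> (snd p + \<sigma> * fst p))"
      by (rule continuous_on_compose2[OF test_torus_continuous[OF \<psi>, of UNIV]]) (auto intro!: continuous_intros)
    from continuous_pairing[OF C_L1_add_scaleR[OF CL(3,2)] this] show ?thesis
      by (simp add: J_def[abs_def])
  qed
  \<comment> \<open>For large n the profile rises from 0 to 1 on [1/n, 2/n] and falls back on
    [t - 2/n, t - 1/n]. Its support lies in [1/n, t - 1/n], which is inside (0, T) even for t =
    T.\<close>
  define \<theta> where "\<theta> n r = smooth_step (real n * r + (-1)) - smooth_step (real n * r + (2 - real n * t))" for n r
  \<comment> \<open>The kernel at s with offset c. \<open>D 1 0\<close> comes from the rise and
    concentrates at 0 from the right; \<open>D (-2) t\<close> comes from the fall and concentrates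
    at t from the left.\<close>
  define D where "D c s n r = (real n * deriv smooth_step (real n * (r - s) - c)) *\<^sub>R J r" for c s n r
  have \<theta>s: "smooth (\<theta> n)" for n
    unfolding \<theta>_def by (rule smooth_diff[OF smooth_step_affine smooth_step_affine])
  have \<theta>d: "deriv (\<theta> n) r *\<^sub>R J r = D 1 0 n r - D (-2) t n r" for n r
  proof -
    have "deriv (\<theta> n) r = real n * deriv smooth_step (real n * r + (-1)) - real n * deriv smooth_step (real n * r + (2 - real n * t))"
      unfolding \<theta>_def by (rule DERIV_imp_deriv[OF DERIV_diff[OF smooth_step_affine_deriv smooth_step_affine_deriv]])
    also have "real n * r + (-1) = real n * (r - 0) - 1" by simp
    also have "real n * r + (2 - real n * t) = real n * (r - t) - (-2)" by (simp add: right_diff_distrib)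
    finally show ?thesis by (simp only: D_def scaleR_diff_left)
  qed
  have D_int: "set_integrable lebesgue {0<..<T} (D c s n)" for c s n
  proof (rule set_integrable_subset)
    show "set_integrable lebesgue {0..T} (D c s n)"
      unfolding D_def
      by (intro absolutely_integrable_continuous_real continuous_intros J
          continuous_on_compose2[OF smooth_continuous[OF smooth_deriv[OF smooth_smooth_step], of UNIV]]) auto
  qed auto
  have "\<forall>\<^sub>F n in sequentially. real n > 3 / t"
    by (rule filterlim_at_top_dense[THEN iffD1, OF filterlim_real_sequentially, rule_format])
  \<comment> \<open>The bound n t > 3 separates rise and fall: before the first step starts the
    second one vanishes, and once the second is complete the first is complete too.\<close>
  then have large: "\<forall>\<^sub>F n in sequentially. real n > 0 \<and> real n * t > 3"
  proof eventually_elim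
    case (elim n)
    moreover have "0 < 3 / t" using t by simp
    ultimately have "0 < real n" by linarith
    then show ?case using elim t by (simp add: field_simps)
  qed
  have "\<forall>\<^sub>F n in sequentially. (LINT r:{0<..<T}|lebesgue. D 1 0 n r) - (LINT r:{0<..<T}|lebesgue. D (-2) t n r) =
      - (\<sigma> *\<^sub>R (LINT p:?X|lebesgue. travelling_wave \<sigma> (\<theta> n) \<psi> p *\<^sub>R F p))"
    using large
  proof eventually_elim
    case (elim n)
    have "(LINT r:{0<..<T}|lebesgue. deriv (\<theta> n) r *\<^sub>R J r) =
        - (\<sigma> *\<^sub>R (LINT p:?X|lebesgue. travelling_wave \<sigma> (\<theta> n) \<psi> p *\<^sub>R F p))"
      unfolding J_def
    proof (rule weak_transport_travelling_wave[OF C v F \<sigma> \<theta>s _ _ _ \<psi>])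
      show "0 < 1 / real n" using elim by simp
      then show "t - 1 / real n < T" using t by linarith
      fix r assume r: "\<theta> n r \<noteq> 0"
      have "1 \<le> real n * r"
      proof (rule ccontr)
        assume "\<not> 1 \<le> real n * r"
        then have "smooth_step (real n * r + (-1)) = 0" "smooth_step (real n * r + (2 - real n * t)) = 0"
          using elim by (intro smooth_step_eq_0; linarith)+
        then show False using r by (simp add: \<theta>_def)
      qed
      moreover have "real n * r \<le> real n * t - 1"
      proof (rule ccontr)
        assume "\<not> real n * r \<le> real n * t - 1"
        then have "smooth_step (real n * r + (-1)) = 1" "smooth_step (real n * r + (2 - real n * t)) = 1"
          using elim by (intro smooth_step_eq_1; linarith)+
        then show False using r by (simp add: \<theta>_def)
      qed
      ultimately show "1 / real n \<le> r \<and> r \<le> t - 1 / real n"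
        using elim by (simp add: field_simps)
    qed
    moreover have "(LINT r:{0<..<T}|lebesgue. deriv (\<theta> n) r *\<^sub>R J r) =
        (LINT r:{0<..<T}|lebesgue. D 1 0 n r) - (LINT r:{0<..<T}|lebesgue. D (-2) t n r)"
      unfolding \<theta>d by (rule set_integral_diff(2)[OF D_int D_int])
    ultimately show ?case by simp
  qed
  moreover have "(\<lambda>n. (LINT r:{0<..<T}|lebesgue. D 1 0 n r) - (LINT r:{0<..<T}|lebesgue. D (-2) t n r)) \<longlonglongrightarrow> J 0 - J t"
  proof (rule tendsto_diff)
    show "(\<lambda>n. LINT r:{0<..<T}|lebesgue. D 1 0 n r) \<longlonglongrightarrow> J 0"
      unfolding D_def
    proof (rule smooth_step_deriv_concentrates[OF J])
      fix y :: real assume y: "y \<in> {0..1}"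
      show "\<forall>\<^sub>F n in sequentially. 0 + (y + 1) / real n \<in> {0<..<T}"
        using large
      proof eventually_elim
        case (elim n)
        have "y + 1 < real n * t" using y elim by auto
        also have "\<dots> \<le> real n * T" using t by (simp add: mult_left_mono)
        finally show ?case using elim y by (simp add: field_simps)
      qed
    qed (use t in auto)
    show "(\<lambda>n. LINT r:{0<..<T}|lebesgue. D (-2) t n r) \<longlonglongrightarrow> J t"
      unfolding D_def
    proof (rule smooth_step_deriv_concentrates[OF J])
      fix y :: real assume y: "y \<in> {0..1}"
      show "\<forall>\<^sub>F n in sequentially. t + (y + - 2) / real n \<in> {0<..<T}"
        using large
      proof eventually_elim
        case (elim n)
        have "(y + -2) / real n < 0" using y elim by (intro divide_neg_pos) auto
        moreover have "- t < (y + -2) / real n" using y elim by (simp add: field_simps)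
        ultimately show ?case using t by auto
      qed
    qed (use t in auto)
  qed
  ultimately have "(\<lambda>n. - (\<sigma> *\<^sub>R (LINT p:?X|lebesgue. travelling_wave \<sigma> (\<theta> n) \<psi> p *\<^sub>R F p))) \<longlonglongrightarrow> J 0 - J t"
    by (rule Lim_transform_eventually[rotated])
  moreover have "(\<lambda>n. - (\<sigma> *\<^sub>R (LINT p:?X|lebesgue. travelling_wave \<sigma> (\<theta> n) \<psi> p *\<^sub>R F p))) \<longlonglongrightarrow>
      - (\<sigma> *\<^sub>R (LINT p:?X|lebesgue. (indicator {0<..<t} (fst p) * \<psi> (snd p + \<sigma> * fst p)) *\<^sub>R F p))"
    unfolding set_lebesgue_integral_def
  proof (intro tendsto_minus tendsto_scaleR tendsto_const)
    obtain K where K: "K > 0" "\<And>x. \<bar>\<psi> x\<bar> \<le> K"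
      using bounded_periodic[OF test_torus_continuous[OF \<psi>]] \<psi> by (auto simp: test_torus_iff)
    have Fi: "integrable lebesgue (\<lambda>p. indicat_real ?X p *\<^sub>R F p)" using Fint by (simp add: set_integrable_def)
    have Fm: "(\<lambda>p. indicat_real ?X p *\<^sub>R F p) \<in> borel_measurable lebesgue"
      by (rule borel_measurable_integrable[OF Fi])
    have swap: "indicat_real ?X p *\<^sub>R c *\<^sub>R F p = c *\<^sub>R (indicat_real ?X p *\<^sub>R F p)" for c p
      by (rule scaleR_left_commute)
    have lim: "(\<lambda>n. \<theta> n r) \<longlonglongrightarrow> indicator {0<..<t} r" for r
    proof -
      have zero: "(\<lambda>n. smooth_step (real n * r + (-1))) \<longlonglongrightarrow> indicator {0<..} r"
      proof (cases "r > 0")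
        case True
        have "\<forall>\<^sub>F n in sequentially. real n > 2 / r"
          by (rule filterlim_at_top_dense[THEN iffD1, OF filterlim_real_sequentially, rule_format])
        then have "\<forall>\<^sub>F n in sequentially. smooth_step (real n * r + (-1)) = 1"
          by eventually_elim (use True in \<open>auto intro!: smooth_step_eq_1 simp: field_simps\<close>)
        then show ?thesis using True by (simp add: tendsto_eventually)
      next
        case False
        then have "smooth_step (real n * r + (-1)) = 0" for n
          by (intro smooth_step_eq_0) (use mult_nonneg_nonpos[of "real n" r] in auto)
        then show ?thesis using False by simp
      qed
      \<comment> \<open>At r = t the argument is 2, so the limit is the indicator of the closed
        half-line; subtracting it leaves the open interval (0, t).\<close>
      have "(\<lambda>n. smooth_step (real n * r + (2 - real n * t))) \<longlonglongrightarrow> indicator {t..} r"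
      proof (cases "r < t")
        case True
        have "\<forall>\<^sub>F n in sequentially. real n > 2 / (t - r)"
          by (rule filterlim_at_top_dense[THEN iffD1, OF filterlim_real_sequentially, rule_format])
        then have "\<forall>\<^sub>F n in sequentially. smooth_step (real n * r + (2 - real n * t)) = 0"
          by eventually_elim (use True in \<open>auto intro!: smooth_step_eq_0 simp: field_simps\<close>)
        then show ?thesis using True by (simp add: tendsto_eventually)
      next
        case False
        then have *: "real n * t \<le> real n * r" for n by (simp add: mult_left_mono)
        have "smooth_step (real n * r + (2 - real n * t)) = 1" for n
          using *[of n] by (intro smooth_step_eq_1) linarith
        then show ?thesis using False by simp
      qed
      from tendsto_diff[OF zero this]
      have "(\<lambda>n. \<theta> n r) \<longlonglongrightarrow> indicator {0<..} r - indicator {t..} r" by (simp add: \<theta>_def)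
      also have "indicator {0<..} r - indicator {t..} r = indicat_real {0<..<t} r"
        using t by (auto simp: indicator_def)
      finally show ?thesis .
    qed
    show "(\<lambda>n. LINT p|lebesgue. indicat_real ?X p *\<^sub>R travelling_wave \<sigma> (\<theta> n) \<psi> p *\<^sub>R F p) \<longlonglongrightarrow>
      (LINT p|lebesgue. indicat_real ?X p *\<^sub>R (indicator {0<..<t} (fst p) * \<psi> (snd p + \<sigma> * fst p)) *\<^sub>R F p)"
      unfolding swap
    proof (rule integral_dominated_convergence[where w = "\<lambda>p. K * norm (indicat_real ?X p *\<^sub>R F p)"])
      have wave: "travelling_wave \<sigma> (\<theta> n) \<psi> \<in> borel_measurable borel" for n
        using continuous_travelling_wave[OF smooth_continuous[OF \<theta>s] test_torus_continuous[OF \<psi>]]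
        by (rule borel_measurable_continuous_onI)
      have wlim: "(\<lambda>n. travelling_wave \<sigma> (\<theta> n) \<psi> p) \<longlonglongrightarrow> indicator {0<..<t} (fst p) * \<psi> (snd p + \<sigma> * fst p)" for p
        unfolding travelling_wave_def case_prod_unfold by (intro tendsto_mult lim tendsto_const)
      show "(\<lambda>p. travelling_wave \<sigma> (\<theta> n) \<psi> p *\<^sub>R indicat_real ?X p *\<^sub>R F p) \<in> borel_measurable lebesgue" for n
        by (intro borel_measurable_scaleR Fm measurable_completion) (simp add: wave)
      have "(\<lambda>p. indicator {0<..<t} (fst p) * \<psi> (snd p + \<sigma> * fst p)) \<in> borel_measurable borel"
        by (rule borel_measurable_LIMSEQ_real[OF wlim wave])
      then show "(\<lambda>p. (indicator {0<..<t} (fst p) * \<psi> (snd p + \<sigma> * fst p)) *\<^sub>R indicat_real ?X p *\<^sub>R F p) \<in> borel_measurable lebesgue"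
        by (intro borel_measurable_scaleR Fm measurable_completion) simp
      show "integrable lebesgue (\<lambda>p. K * norm (indicat_real ?X p *\<^sub>R F p))"
        by (intro integrable_mult_right integrable_norm Fi)
      show "AE p in lebesgue. (\<lambda>n. travelling_wave \<sigma> (\<theta> n) \<psi> p *\<^sub>R indicat_real ?X p *\<^sub>R F p) \<longlonglongrightarrow>
          (indicator {0<..<t} (fst p) * \<psi> (snd p + \<sigma> * fst p)) *\<^sub>R indicat_real ?X p *\<^sub>R F p"
        by (intro AE_I2 tendsto_scaleR wlim tendsto_const)
      show "AE p in lebesgue. norm (travelling_wave \<sigma> (\<theta> n) \<psi> p *\<^sub>R indicat_real ?X p *\<^sub>R F p) \<le> K * norm (indicat_real ?X p *\<^sub>R F p)" for n
      proof (rule AE_I2)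
        fix p :: "real \<times> real"
        have "\<bar>\<theta> n (fst p)\<bar> \<le> 1"
          using smooth_step_nonneg[of "real n * fst p + (-1)"] smooth_step_le_1[of "real n * fst p + (-1)"]
            smooth_step_nonneg[of "real n * fst p + (2 - real n * t)"]
            smooth_step_le_1[of "real n * fst p + (2 - real n * t)"]
          unfolding \<theta>_def abs_le_iff by linarith
        then have "\<bar>travelling_wave \<sigma> (\<theta> n) \<psi> p\<bar> \<le> 1 * K"
          unfolding travelling_wave_def case_prod_unfold abs_mult using K by (intro mult_mono) auto
        then show "norm (travelling_wave \<sigma> (\<theta> n) \<psi> p *\<^sub>R indicat_real ?X p *\<^sub>R F p) \<le> K * norm (indicat_real ?X p *\<^sub>R F p)"
          unfolding norm_scaleR[of "travelling_wave \<sigma> (\<theta> n) \<psi> p"] by (intro mult_right_mono) auto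
      qed
    qed
  qed
  ultimately have "J 0 - J t = - (\<sigma> *\<^sub>R (LINT p:?X|lebesgue. (indicator {0<..<t} (fst p) * \<psi> (snd p + \<sigma> * fst p)) *\<^sub>R F p))"
    by (rule LIMSEQ_unique)
  from arg_cong[OF this, of uminus]
  have "J t - J 0 = \<sigma> *\<^sub>R (LINT p:?X|lebesgue. (indicator {0<..<t} (fst p) * \<psi> (snd p + \<sigma> * fst p)) *\<^sub>R F p)"
    by (simp only: minus_diff_eq minus_minus)
  then show ?thesis by (simp add: J_def)
qed

text \<open>The difference of the two sides combines three functionals of the kind in
  \<open>bcf_integral\<close>: a translation by \<sigma> t and the identity on the line, and the
  shear x + \<sigma> s on the plane. It vanishes on test functions by
  \<open>transport_integrated\<close>, hence on indicators of periodized Borel sets.\<close>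

lemma transport_periodic_set:
  assumes C: "C_H1_L2 T u v" and v: "has_weak_time_deriv T u v" and F: "solves_wave_eq T u F"
    and \<sigma>: "\<sigma> * \<sigma> = 1"
    and Fint: "set_integrable lebesgue ({0<..<T} \<times> {0..2*pi}) F"
    and A: "A \<in> sets borel" "A \<subseteq> {0<..<2*pi}" and t: "t \<in> {0..T}"
  shows "(LINT x:{0..2*pi}|lebesgue. indicator (periodize A) (x + \<sigma> * t) *\<^sub>R (weak_deriv (u t) x + \<sigma> *\<^sub>R v t x)) -
      (LINT x:{0..2*pi}|lebesgue. indicator (periodize A) x *\<^sub>R (weak_deriv (u 0) x + \<sigma> *\<^sub>R v 0 x)) =
    \<sigma> *\<^sub>R (LINT p:{0<..<T} \<times> {0..2*pi}|lebesgue.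
      (indicator {0<..<t} (fst p) * indicator (periodize A) (snd p + \<sigma> * fst p)) *\<^sub>R F p)"
proof -
  let ?S = "{0..2*pi}" and ?X = "{0<..<T} \<times> {0..2*pi}"
  let ?w = "\<lambda>t x. weak_deriv (u t) x + \<sigma> *\<^sub>R v t x"
  define \<Lambda>\<^sub>t where "\<Lambda>\<^sub>t g = (LINT x|lebesgue. g (x + \<sigma> * t) *\<^sub>R (indicat_real ?S x *\<^sub>R ?w t x))" for g
  define \<Lambda>\<^sub>0 where "\<Lambda>\<^sub>0 g = (LINT x|lebesgue. g x *\<^sub>R (indicat_real ?S x *\<^sub>R ?w 0 x))" for g
  define \<Lambda>\<^sub>F where "\<Lambda>\<^sub>F g = (LINT p|lebesgue. g (snd p + \<sigma> * fst p) *\<^sub>R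
      (indicat_real {0<..<t} (fst p) *\<^sub>R (indicat_real ?X p *\<^sub>R F p)))" for g
  define \<Lambda> where "\<Lambda> g = (\<Lambda>\<^sub>t g - 1 *\<^sub>R \<Lambda>\<^sub>0 g) - \<sigma> *\<^sub>R \<Lambda>\<^sub>F g" for g
  have w: "integrable lebesgue (\<lambda>x. indicat_real ?S x *\<^sub>R ?w r x)" if "r \<in> {0..T}" for r
    using C_L1_integrable[OF C_L1_add_scaleR[OF C_H1_L2_imp_C_L1(3,2)[OF C]] that]
    by (simp add: set_integrable_def)
  have borel_imp: "f \<in> borel_measurable borel \<Longrightarrow> f \<in> borel_measurable lebesgue"
    for f :: "'a::euclidean_space \<Rightarrow> real"
    by (intro measurable_completion) simp
  have "bounded_convergence_functional \<Lambda>\<^sub>t"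
    unfolding \<Lambda>\<^sub>t_def[abs_def] by (intro bcf_integral w t borel_imp) measurable
  moreover have "bounded_convergence_functional \<Lambda>\<^sub>0"
    unfolding \<Lambda>\<^sub>0_def[abs_def] using t by (intro bcf_integral w borel_imp) auto
  moreover have "bounded_convergence_functional \<Lambda>\<^sub>F"
    unfolding \<Lambda>\<^sub>F_def[abs_def]
  proof (intro bcf_integral borel_imp)
    have fst: "(\<lambda>p::real \<times> real. indicat_real {0<..<t} (fst p)) \<in> borel_measurable lebesgue"
      by (intro borel_imp) (simp add: borel_prod[symmetric])
    have i: "integrable lebesgue (\<lambda>p. indicat_real ?X p *\<^sub>R F p)" using Fint by (simp add: set_integrable_def)
    show "integrable lebesgue (\<lambda>p. indicat_real {0<..<t} (fst p) *\<^sub>R (indicat_real ?X p *\<^sub>R F p))"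
    proof (rule Bochner_Integration.integrable_bound[OF i])
      show "(\<lambda>p. indicat_real {0<..<t} (fst p) *\<^sub>R (indicat_real ?X p *\<^sub>R F p)) \<in> borel_measurable lebesgue"
        by (intro borel_measurable_scaleR fst borel_measurable_integrable[OF i])
      show "AE p in lebesgue. norm (indicat_real {0<..<t} (fst p) *\<^sub>R (indicat_real ?X p *\<^sub>R F p)) \<le> norm (indicat_real ?X p *\<^sub>R F p)"
        by (intro AE_I2) (simp add: indicator_def)
    qed
    show "(\<lambda>p. snd p + \<sigma> * fst p) \<in> borel_measurable borel"
      by (intro borel_measurable_continuous_onI continuous_intros)
  qed
  ultimately have bcf: "bounded_convergence_functional \<Lambda>"
    unfolding \<Lambda>_def[abs_def] by (intro bcf_combine)
  have eq: "\<Lambda> g = ((LINT x:?S|lebesgue. g (x + \<sigma> * t) *\<^sub>R ?w t x) - (LINT x:?S|lebesgue. g x *\<^sub>R ?w 0 x)) -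
      \<sigma> *\<^sub>R (LINT p:?X|lebesgue. (indicator {0<..<t} (fst p) * g (snd p + \<sigma> * fst p)) *\<^sub>R F p)" for g
    unfolding \<Lambda>_def \<Lambda>\<^sub>t_def \<Lambda>\<^sub>0_def \<Lambda>\<^sub>F_def set_lebesgue_integral_def by (simp add: ac_simps)
  have "\<Lambda> (indicator (periodize A)) = 0"
  proof (rule bcf_periodic_eq_0[OF bcf _ A])
    fix \<psi> :: "real \<Rightarrow> real" assume "\<psi> \<in> test_torus"
    from transport_integrated[OF C v F \<sigma> Fint this t] show "\<Lambda> \<psi> = 0" unfolding eq by simp
  qed
  then show ?thesis unfolding eq by simp
qed

section \<open>Observable sets\<close>

lemma null_sets_image_plus:
  fixes c :: real
  assumes "N \<in> null_sets lebesgue"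
  shows "(+) c ` N \<in> null_sets lebesgue"
  using negligible_translation[of N c] assms by (simp add: negligible_iff_null_sets)

lemma null_sets_periodize: "N \<in> null_sets lebesgue \<Longrightarrow> periodize N \<in> null_sets lebesgue"
  unfolding periodize_eq_UN by (intro null_sets_UN null_sets_image_plus)

lemma sets_lebesgue_periodize: "A \<in> sets lebesgue \<Longrightarrow> periodize A \<in> sets lebesgue"
  unfolding periodize_eq_UN using lebesgue_sets_translation by (intro sets.countable_UN') blast+

lemma vimage_plus_eq_image: "{x. x + c \<in> N} = (+) (- c) ` N" for c :: real
  by force

lemma AE_translate_not_in:
  fixes c :: real
  assumes "N \<in> null_sets lebesgue"
  shows "AE x in lebesgue. x + c \<notin> N"
  using AE_not_in[OF null_sets_image_plus[OF assms, of "- c"]]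
  unfolding vimage_plus_eq_image[symmetric] by simp

text \<open>At each fixed first coordinate the slice of the preimage is a translate of a null set,
  so Fubini applies. The Borel null superset \<open>N'\<close> makes the preimage
  measurable.\<close>

lemma AE_shear_not_in:
  fixes c :: real
  assumes "N \<in> null_sets (lebesgue :: real measure)"
  shows "AE p in lebesgue. snd p + c * fst p \<notin> N"
proof -
  obtain N' where N': "N' \<in> null_sets lborel" "N \<subseteq> N'"
    using assms null_sets_completion_iff2[of N lborel] by blast
  let ?Q = "{p :: real \<times> real. snd p + c * fst p \<in> N'}"
  have "(\<lambda>p :: real \<times> real. snd p + c * fst p) \<in> borel_measurable borel"
    by (intro borel_measurable_continuous_onI continuous_intros)
  from measurable_sets[OF this, of N'] have Q: "?Q \<in> sets (lborel \<Otimes>\<^sub>M lborel)"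
    using N'(1) unfolding lborel_prod by (simp add: vimage_def null_sets_def)
  have "emeasure lborel (Pair t -` ?Q) = 0" for t
  proof -
    have "Pair t -` ?Q = {x. x - (- (c * t)) \<in> N'}" by (auto simp: vimage_def)
    then show ?thesis using null_sets_translation[OF N'(1), of "- (c * t)"] by auto
  qed
  then have "emeasure (lborel \<Otimes>\<^sub>M lborel) ?Q = 0"
    by (subst lborel.emeasure_pair_measure_alt[OF Q]) simp
  then have "?Q \<in> null_sets lborel" using Q unfolding lborel_prod by (simp add: null_setsI)
  then have "AE p in lebesgue. p \<notin> ?Q" by (intro AE_not_in null_sets_completionI)
  then show ?thesis by eventually_elim (use N'(2) in auto)
qed

section \<open>Translates modulo 2 pi and integrals over them\<close>

lemma mem_translate_mod_iff:
  "x \<in> translate_mod A c \<longleftrightarrow> x \<in> {0..<2*pi} \<and> x + (- c) \<in> periodize A"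
proof
  assume "x \<in> translate_mod A c"
  then obtain a where a: "a \<in> A" "x = (a + c) rmod (2 * pi)" by (auto simp: translate_mod_def)
  then have "x + (- c) = a + 2 * pi * of_int (- \<lfloor>(a + c) / \<bar>2 * pi\<bar>\<rfloor>)" by (simp add: rmod_def)
  then have "x + (- c) \<in> periodize A" using a(1) unfolding periodize_def by blast
  then show "x \<in> {0..<2*pi} \<and> x + (- c) \<in> periodize A"
    using a(2) rmod_nonneg[of "2*pi" "a + c"] rmod_less[of "2*pi" "a + c"] by simp
next
  assume x: "x \<in> {0..<2*pi} \<and> x + (- c) \<in> periodize A"
  then obtain a k where a: "a \<in> A" "x + (- c) = a + 2 * pi * of_int k" unfolding periodize_def by blast
  then have "a + c = x + of_int (- k) * (2 * pi)" by (simp add: algebra_simps)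
  then have "(a + c) rmod (2 * pi) = x" using x by (intro rmod_unique[where n = "- k"]) auto
  then show "x \<in> translate_mod A c" using a(1) unfolding translate_mod_def by blast
qed

lemma periodize_iff_of_notin_diff:
  assumes "A\<^sub>0 \<subseteq> A" "y \<notin> periodize (A - A\<^sub>0)"
  shows "y \<in> periodize A \<longleftrightarrow> y \<in> periodize A\<^sub>0"
  using assms unfolding periodize_def by blast

lemma sets_lebesgue_translate_mod:
  assumes "A \<in> sets lebesgue"
  shows "translate_mod A c \<in> sets lebesgue"
proof -
  have "translate_mod A c = {0..<2*pi} \<inter> (+) c ` periodize A"
    using vimage_plus_eq_image[of "- c" "periodize A"] mem_translate_mod_iff[of _ A c] by auto
  then show ?thesis
    using sets.Int[OF _ lebesgue_sets_translation[OF sets_lebesgue_periodize[OF assms]], of "{0..<2*pi}" c] by simp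
qed

text \<open>Residues lie in [0, 2 pi), so the translate and the periodized set differ on [0, 2 pi]
  at most in the point 2 pi. Replacing \<open>A\<close> by \<open>A\<^sub>0\<close> changes the
  integrand only on a null set, because periodizing and translating preserve null sets.\<close>

lemma integral_translate_mod_eq:
  fixes w :: "real \<Rightarrow> complex"
  assumes A: "A \<in> sets lebesgue" and A\<^sub>0: "A\<^sub>0 \<in> sets lebesgue" "A\<^sub>0 \<subseteq> A" "A - A\<^sub>0 \<in> null_sets lebesgue"
    and w: "set_integrable lebesgue {0..2*pi} w"
  shows "(LINT x:translate_mod A c|lebesgue. w x) =
    (LINT x:{0..2*pi}|lebesgue. indicator (periodize A\<^sub>0) (x + (- c)) *\<^sub>R w x)"
proof -
  define W where "W x = indicat_real {0..2*pi} x *\<^sub>R w x" for x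
  have W: "W \<in> borel_measurable lebesgue"
    using w unfolding W_def set_integrable_def by (rule borel_measurable_integrable)
  have "(LINT x:translate_mod A c|lebesgue. w x) = (LINT x|lebesgue. indicat_real (translate_mod A c) x *\<^sub>R W x)"
    unfolding set_lebesgue_integral_def W_def
    by (intro Bochner_Integration.integral_cong refl) (auto simp: indicator_def mem_translate_mod_iff)
  also have "\<dots> = (LINT x|lebesgue. indicat_real (periodize A\<^sub>0) (x + (- c)) *\<^sub>R W x)"
  proof (rule integral_cong_AE)
    show "(\<lambda>x. indicat_real (translate_mod A c) x *\<^sub>R W x) \<in> borel_measurable lebesgue"
      by (intro borel_measurable_scaleR borel_measurable_indicator W sets_lebesgue_translate_mod A)
    have "(\<lambda>x. indicat_real (periodize A\<^sub>0) (x + (- c))) = indicat_real ((+) c ` periodize A\<^sub>0)"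
      using vimage_plus_eq_image[of "- c" "periodize A\<^sub>0"] by (auto simp: fun_eq_iff indicator_def)
    then show "(\<lambda>x. indicat_real (periodize A\<^sub>0) (x + (- c)) *\<^sub>R W x) \<in> borel_measurable lebesgue"
      by (intro borel_measurable_scaleR W)
        (simp add: borel_measurable_indicator lebesgue_sets_translation sets_lebesgue_periodize A\<^sub>0)
    have "AE x in lebesgue. x + (- c) \<notin> periodize (A - A\<^sub>0)"
      by (rule AE_translate_not_in[OF null_sets_periodize[OF A\<^sub>0(3)]])
    moreover have "AE x in lebesgue. x + 0 \<notin> {2 * pi}"
      by (rule AE_translate_not_in) (intro null_sets_completionI finite_imp_null_set_lborel, simp)
    ultimately show "AE x in lebesgue. indicat_real (translate_mod A c) x *\<^sub>R W x =
        indicat_real (periodize A\<^sub>0) (x + (- c)) *\<^sub>R W x"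
    proof eventually_elim
      case (elim x)
      then show ?case
        using periodize_iff_of_notin_diff[OF A\<^sub>0(2), of "x + (- c)"] mem_translate_mod_iff[of x A c]
        by (auto simp: W_def indicator_def)
    qed
  qed
  also have "\<dots> = (LINT x:{0..2*pi}|lebesgue. indicator (periodize A\<^sub>0) (x + (- c)) *\<^sub>R w x)"
    unfolding set_lebesgue_integral_def W_def by (simp add: ac_simps)
  finally show ?thesis .
qed

lemma periodize_Icc: "y \<in> periodize {0..2*pi}"
proof -
  have "y \<in> periodize {0..<2*pi}"
    using rmod_nonneg[of "2*pi" y] rmod_less[of "2*pi" y] by (subst periodize_iff) auto
  then show ?thesis unfolding periodize_def by fastforce
qed

text \<open>A subset of [0, 2 pi] of measure 2 pi has null complement there. This complement stays
  null after periodizing and translating, so the translate contains almost every point of the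
  fundamental domain.\<close>

lemma integral_translate_mod_full:
  fixes w :: "real \<Rightarrow> complex"
  assumes A: "A \<in> sets lebesgue" "A \<subseteq> {0..2*pi}" "measure lebesgue A = 2 * pi"
    and w: "set_integrable lebesgue {0..2*pi} w"
  shows "(LINT x:translate_mod A c|lebesgue. w x) = (LINT x:{0..2*pi}|lebesgue. w x)"
proof -
  have "emeasure lebesgue A \<le> emeasure lebesgue {0..2*pi}" using A by (intro emeasure_mono) auto
  then have fin: "emeasure lebesgue A \<noteq> \<infinity>" by (auto simp: top_unique)
  have "emeasure lebesgue ({0..2*pi} - A) = emeasure lebesgue {0..2*pi} - emeasure lebesgue A"
    using A fin by (intro emeasure_Diff) auto
  also have "emeasure lebesgue A = ennreal (2 * pi)"
    using emeasure_eq_ennreal_measure[OF fin[unfolded infinity_ennreal_def]] A(3) by simp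
  finally have "{0..2*pi} - A \<in> null_sets lebesgue" using A(1) by (intro null_setsI sets.Diff) auto
  then have "AE x in lebesgue. x + (- c) \<notin> periodize ({0..2*pi} - A)"
    by (intro AE_translate_not_in null_sets_periodize)
  then have full: "AE x in lebesgue. x + (- c) \<in> periodize A"
    by eventually_elim (use periodize_iff_of_notin_diff[OF A(2)] periodize_Icc in blast)
  define W where "W x = indicat_real {0..2*pi} x *\<^sub>R w x" for x
  have W: "W \<in> borel_measurable lebesgue"
    using w unfolding W_def set_integrable_def by (rule borel_measurable_integrable)
  have "(LINT x:translate_mod A c|lebesgue. w x) = (LINT x|lebesgue. indicat_real (translate_mod A c) x *\<^sub>R W x)"
    unfolding set_lebesgue_integral_def W_def
    by (intro Bochner_Integration.integral_cong refl) (auto simp: indicator_def mem_translate_mod_iff)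
  also have "\<dots> = (LINT x|lebesgue. W x)"
  proof (rule integral_cong_AE)
    show "(\<lambda>x. indicat_real (translate_mod A c) x *\<^sub>R W x) \<in> borel_measurable lebesgue"
      by (intro borel_measurable_scaleR borel_measurable_indicator W sets_lebesgue_translate_mod A)
    have "AE x in lebesgue. x + 0 \<notin> {2 * pi}"
      by (rule AE_translate_not_in) (intro null_sets_completionI finite_imp_null_set_lborel, simp)
    with full show "AE x in lebesgue. indicat_real (translate_mod A c) x *\<^sub>R W x = W x"
    proof eventually_elim
      case (elim x)
      then show ?case
        using mem_translate_mod_iff[of x A c] by (auto simp: W_def indicator_def)
    qed
  qed (rule W)
  finally show ?thesis by (simp add: W_def set_lebesgue_integral_def)
qed

text \<open>On a rectangle of finite measure, |f| \<le> 1 + |f|^2 gives integrability from square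
  integrability.\<close>

lemma source_set_integrable:
  assumes f: "f \<in> L2_cylinder T" and G: "G \<in> sets lebesgue"
  shows "set_integrable lebesgue ({0<..<T} \<times> {0..2*pi}) (\<lambda>p. f p * indicator G p)"
  unfolding set_integrable_def
proof (rule Bochner_Integration.integrable_bound)
  let ?X = "{0<..<T} \<times> {0..2*pi}"
  have "?X \<in> lmeasurable"
    by (intro bounded_set_imp_lmeasurable bounded_Times) (auto simp: sets_completionI_sets borel_Times)
  then have "integrable lebesgue (indicat_real ?X)"
    by (intro integrable_real_indicator) (auto simp: fmeasurable_def)
  moreover have "integrable lebesgue (\<lambda>p. indicat_real ?X p *\<^sub>R (norm (f p))\<^sup>2)"
    using f by (simp add: L2_cylinder_def set_integrable_def)
  ultimately show "integrable lebesgue (\<lambda>p. indicat_real ?X p + indicat_real ?X p *\<^sub>R (norm (f p))\<^sup>2)"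
    by (rule Bochner_Integration.integrable_add)
  have "(\<lambda>p. indicat_real ?X p *\<^sub>R f p) \<in> borel_measurable lebesgue"
    using f by (simp add: L2_cylinder_def set_borel_measurable_def)
  then have "(\<lambda>p. (indicat_real ?X p *\<^sub>R f p) * indicator G p) \<in> borel_measurable lebesgue"
    by (intro borel_measurable_times borel_measurable_indicator G)
  then show "(\<lambda>p. indicat_real ?X p *\<^sub>R (f p * indicator G p)) \<in> borel_measurable lebesgue"
    by simp
  have y: "y \<le> 1 + y\<^sup>2" for y :: real
    using sum_squares_ge_zero[of "y - 1/2" "0"] by (simp add: power2_eq_square algebra_simps)
  show "AE p in lebesgue. norm (indicat_real ?X p *\<^sub>R (f p * indicator G p)) \<le>
      norm (indicat_real ?X p + indicat_real ?X p *\<^sub>R (norm (f p))\<^sup>2)"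
    using y by (intro AE_I2) (auto simp: indicator_def add_nonneg_nonneg)
qed

text \<open>The constant 1 is a periodic test function with derivative 0.\<close>

lemma integral_weak_deriv_eq_0:
  assumes "g \<in> H1_torus"
  shows "(LINT x:{0..2*pi}|lebesgue. weak_deriv g x) = 0"
proof -
  have "(\<lambda>x. 1) \<in> test_torus" by (simp add: test_torus_iff smooth_const periodic_2pi_def)
  from weak_deriv_has_weak_deriv[OF assms, unfolded has_weak_deriv_def, rule_format, OF this]
  show ?thesis by (simp add: set_lebesgue_integral_def)
qed

theorem proposition1p2:
  fixes T :: real and A B :: "real set" and G :: "(real \<times> real) set"
    and f :: "real \<times> real \<Rightarrow> complex" and u u\<^sub>t :: "real \<Rightarrow> real \<Rightarrow> complex"
  assumes "T > 0"
    and "A \<subseteq> {0..2*pi}" and "A \<in> sets lebesgue"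
    and "B \<subseteq> {0..2*pi}" and "B \<in> sets lebesgue"
    and "G \<subseteq> {0..T} \<times> {0..2*pi}" and "G \<in> sets lebesgue"
    and "observable_symmetric T A B G"
    and "f \<in> L2_cylinder T"
    and "C_H1_L2 T u u\<^sub>t"
    and "has_weak_time_deriv T u u\<^sub>t"
    and "solves_wave_eq T u (\<lambda>p. f p * indicator G p)"
    and "u 0 \<in> H1_torus" and "u\<^sub>t 0 \<in> L2_torus"
  shows "(\<forall>t\<in>{0..T}. I_functional A B u u\<^sub>t t = I_functional A B u u\<^sub>t 0) \<and>
    (measure lebesgue A = 2 * pi \<and> measure lebesgue B = 2 * pi \<longrightarrow>
      (\<forall>t\<in>{0..T}.
        I_functional A B u u\<^sub>t t = 2 * (LINT x:{0..2*pi}|lebesgue. weak_deriv (u t) x) \<and>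
        (LINT x:{0..2*pi}|lebesgue. weak_deriv (u t) x) = 0))"
proof (intro conjI ballI impI)
  let ?S = "{0..2*pi}" and ?X = "{0<..<T} \<times> {0..2*pi}"
  let ?w = "\<lambda>\<sigma> t x. weak_deriv (u t) x + \<sigma> *\<^sub>R u\<^sub>t t x"
  define F where "F = (\<lambda>p. f p * indicator G p)"
  have F: "solves_wave_eq T u F" "set_integrable lebesgue ?X F"
    using assms(12) source_set_integrable[OF assms(9,7)] by (auto simp: F_def)
  note CL = C_H1_L2_imp_C_L1[OF assms(10)]
  have w: "set_integrable lebesgue ?S (?w \<sigma> t)" if "t \<in> {0..T}" for \<sigma> t
    using C_L1_integrable[OF C_L1_add_scaleR[OF CL(3,2)] that] .
  have I: "I_functional A B u u\<^sub>t t =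
      (LINT x:translate_mod A (- t)|lebesgue. ?w 1 t x) + (LINT x:translate_mod B t|lebesgue. ?w (-1) t x)" for t
    by (simp add: I_functional_def)
  {
    fix t assume t: "t \<in> {0..T}"
    then have T0: "0 \<in> {0..T}" by auto
    obtain A\<^sub>0 where A0: "A\<^sub>0 \<in> sets borel" "A\<^sub>0 \<subseteq> A \<inter> {0<..<2*pi}" "A \<inter> ?S - A\<^sub>0 \<in> null_sets lebesgue"
      using borel_core[OF assms(3)] .
    obtain B\<^sub>0 where B0: "B\<^sub>0 \<in> sets borel" "B\<^sub>0 \<subseteq> B \<inter> {0<..<2*pi}" "B \<inter> ?S - B\<^sub>0 \<in> null_sets lebesgue"
      using borel_core[OF assms(5)] .
    have [simp]: "A \<inter> ?S = A" "B \<inter> ?S = B" using assms(2,4) by auto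
    let ?KA = "\<lambda>p. (indicat_real {0<..<t} (fst p) * indicator (periodize A\<^sub>0) (snd p + 1 * fst p)) *\<^sub>R F p"
    let ?KB = "\<lambda>p. (indicat_real {0<..<t} (fst p) * indicator (periodize B\<^sub>0) (snd p + (-1) * fst p)) *\<^sub>R F p"
    \<comment> \<open>Shifting A by -r imposes the condition on x + r, the characteristic coordinate
      for \<sigma> = 1; shifting B by r imposes it on x - r, the one for \<sigma> = -1.\<close>
    have IA: "(LINT x:translate_mod A (- r)|lebesgue. ?w 1 r x) =
        (LINT x:?S|lebesgue. indicator (periodize A\<^sub>0) (x + 1 * r) *\<^sub>R ?w 1 r x)" if "r \<in> {0..T}" for r
      using integral_translate_mod_eq[OF assms(3) _ _ _ w[OF that], of A\<^sub>0 "- r" 1] A0 by simp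
    have IB: "(LINT x:translate_mod B r|lebesgue. ?w (-1) r x) =
        (LINT x:?S|lebesgue. indicator (periodize B\<^sub>0) (x + (-1) * r) *\<^sub>R ?w (-1) r x)" if "r \<in> {0..T}" for r
      using integral_translate_mod_eq[OF assms(5) _ _ _ w[OF that], of B\<^sub>0 r "-1"] B0 by simp
    have A: "(LINT x:translate_mod A (- t)|lebesgue. ?w 1 t x) - (LINT x:translate_mod A (- 0)|lebesgue. ?w 1 0 x) =
        1 *\<^sub>R (LINT p:?X|lebesgue. ?KA p)"
      unfolding IA[OF t] IA[OF T0]
      using transport_periodic_set[OF assms(10,11) F(1) _ F(2) A0(1) _ t, of 1] A0(2) by simp
    have B: "(LINT x:translate_mod B t|lebesgue. ?w (-1) t x) - (LINT x:translate_mod B 0|lebesgue. ?w (-1) 0 x) =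
        (-1) *\<^sub>R (LINT p:?X|lebesgue. ?KB p)"
      unfolding IB[OF t] IB[OF T0]
      using transport_periodic_set[OF assms(10,11) F(1) _ F(2) B0(1) _ t, of "-1"] B0(2) by simp
    have "AE p in lebesgue. p \<notin> sym_diff (G \<inter> L_xi T A) (G \<inter> L_eta T B)"
      using assms(8) unfolding observable_symmetric_def by (rule AE_not_in)
    moreover have "AE p in lebesgue. snd p + 1 * fst p \<notin> periodize (A - A\<^sub>0)"
      using A0(3) by (intro AE_shear_not_in null_sets_periodize) simp
    moreover have "AE p in lebesgue. snd p + (-1) * fst p \<notin> periodize (B - B\<^sub>0)"
      using B0(3) by (intro AE_shear_not_in null_sets_periodize) simp
    \<comment> \<open>Off G the source vanishes. On G, outside the null symmetric difference, x + t
      lies in the periodized A exactly when x - t lies in the periodized B; the other two null sets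
      transfer this equivalence to the Borel cores.\<close>
    ultimately have K: "AE p in lebesgue. indicat_real ?X p *\<^sub>R ?KA p = indicat_real ?X p *\<^sub>R ?KB p"
    proof eventually_elim
      case (elim p)
      show ?case
      proof (cases "p \<in> ?X \<inter> G")
        case True
        then have "p \<in> L_xi T A \<longleftrightarrow> p \<in> L_eta T B" using elim(1) by auto
        then have "snd p + fst p \<in> periodize A \<longleftrightarrow> snd p - fst p \<in> periodize B"
          using True by (auto simp: L_xi_def L_eta_def)
        moreover have "snd p + 1 * fst p \<in> periodize A \<longleftrightarrow> snd p + 1 * fst p \<in> periodize A\<^sub>0"
          using A0(2) by (intro periodize_iff_of_notin_diff elim(2)) auto
        moreover have "snd p + (-1) * fst p \<in> periodize B \<longleftrightarrow> snd p + (-1) * fst p \<in> periodize B\<^sub>0"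
          using B0(2) by (intro periodize_iff_of_notin_diff elim(3)) auto
        ultimately show ?thesis by (simp add: indicator_def)
      next
        case False
        then show ?thesis by (auto simp: F_def indicator_def)
      qed
    qed
    \<comment> \<open>Here the Borel property of the cores matters: composing the indicator of a
      Borel set with a shear stays measurable.\<close>
    have meas: "(\<lambda>p. indicat_real ?X p *\<^sub>R ((indicat_real {0<..<t} (fst p) * indicator P (snd p + c * fst p)) *\<^sub>R F p))
        \<in> borel_measurable lebesgue" if P: "P \<in> sets borel" for P and c :: real
    proof -
      have "(\<lambda>p :: real \<times> real. indicat_real {0<..<t} (fst p)) \<in> borel_measurable borel"
        by (simp add: borel_prod[symmetric])
      moreover have "(\<lambda>p :: real \<times> real. snd p + c * fst p) \<in> borel_measurable borel"
        by (intro borel_measurable_continuous_onI continuous_intros)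
      from measurable_compose[OF this borel_measurable_indicator[OF P]]
      have "(\<lambda>p :: real \<times> real. indicat_real P (snd p + c * fst p)) \<in> borel_measurable borel" .
      ultimately have "(\<lambda>p. indicat_real {0<..<t} (fst p) * indicat_real P (snd p + c * fst p)) \<in> borel_measurable lebesgue"
        by (intro measurable_completion) simp
      moreover have "(\<lambda>p. indicat_real ?X p *\<^sub>R F p) \<in> borel_measurable lebesgue"
        using F(2) unfolding set_integrable_def by (rule borel_measurable_integrable)
      ultimately have "(\<lambda>p. (indicat_real {0<..<t} (fst p) * indicat_real P (snd p + c * fst p)) *\<^sub>R (indicat_real ?X p *\<^sub>R F p))
          \<in> borel_measurable lebesgue"
        by (rule borel_measurable_scaleR)
      then show ?thesis by (simp only: scaleR_left_commute)
    qed
    have "(LINT p:?X|lebesgue. ?KA p) = (LINT p:?X|lebesgue. ?KB p)"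
      unfolding set_lebesgue_integral_def
      by (rule integral_cong_AE[OF meas meas K])
        (intro sets_borel_periodize A0(1) B0(1))+
    \<comment> \<open>The equal source integrals enter A and B with opposite signs, so the changes
      of the two terms of I cancel.\<close>
    then show "I_functional A B u u\<^sub>t t = I_functional A B u u\<^sub>t 0"
      using A B unfolding I by (simp add: algebra_simps)
  next
    fix t assume t: "t \<in> {0..T}" and full: "measure lebesgue A = 2 * pi \<and> measure lebesgue B = 2 * pi"
    have H1: "u t \<in> H1_torus" using assms(10) t by (simp add: C_H1_L2_def)
    note int = C_L1_integrable[OF CL(3) t] C_L1_integrable[OF CL(2) t]
    have "I_functional A B u u\<^sub>t t = (LINT x:?S|lebesgue. ?w 1 t x) + (LINT x:?S|lebesgue. ?w (-1) t x)"
      unfolding I using full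
      by (simp only: integral_translate_mod_full[OF assms(3,2) _ w[OF t]]
          integral_translate_mod_full[OF assms(5,4) _ w[OF t]])
    \<comment> \<open>Over the same domain the time-derivative terms have opposite signs and
      cancel.\<close>
    also have "\<dots> = 2 * (LINT x:?S|lebesgue. weak_deriv (u t) x)"
      using set_integral_add(2)[OF int] set_integral_diff(2)[OF int] by simp
    finally show "I_functional A B u u\<^sub>t t = 2 * (LINT x:?S|lebesgue. weak_deriv (u t) x)" .
    show "(LINT x:?S|lebesgue. weak_deriv (u t) x) = 0" by (rule integral_weak_deriv_eq_0[OF H1])
  }
qed

end
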